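(* Let $F$ be a finite direct product of fields of characteristic zero, and let $\mathcal{C}$ be an $F$-linear triangulated category equipped with a bounded weight structure $w=(\mathcal{C}_{w\le 0},\mathcal{C}_{w\ge 0})$ and with a bounded $t$-structure $t=(\mathcal{C}^{t\le 0},\mathcal{C}^{t\ge 0})$ which is transversal to $w$. Let $n\in\mathbb{Z}$, $M\in\mathcal{C}_{w\ge n}$, $N\in\mathcal{C}_{w\le n}$, and let $\alpha:M\to N$ be a morphism. Then the following are equivalent: (1) $H^m(\alpha)=0$ for all $m\in\mathbb{Z}$; (2) $\alpha\in\operatorname{rad}_{\mathcal{C}}(M,N)$.
   Context: A weight structure (Bondarko) on $\mathcal{C}$ is a pair of full subcategories $(\mathcal{C}_{w\le 0},\mathcal{C}_{w\ge 0})$, closed under direct factors, such that, with $\mathcal{C}_{w\le n}:=\mathcal{C}_{w\le 0}[n]$ and $\mathcal{C}_{w\ge n}:=\mathcal{C}_{w\ge 0}[n]$: $\mathcal{C}_{w\le 0}\subset\mathcal{C}_{w\le 1}$ and $\mathcal{C}_{w\ge 1}\subset\mathcal{C}_{w\ge 0}$; $\operatorname{Hom}_{\mathcal{C}}(A,B)=0$ for $A\in\mathcal{C}_{w\le 0}$, $B\in\mathcal{C}_{w\ge 1}$; every object $M$ sits in an exact triangle $A\to M\to B\to A[1]$ with $A\in\mathcal{C}_{w\le 0}$, $B\in\mathcal{C}_{w\ge 1}$. Put $\mathcal{C}_{w=n}:=\mathcal{C}_{w\le n}\cap\mathcal{C}_{w\ge n}$. It is bounded if every object lies in $\mathcal{C}_{w\ge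 a}\cap\mathcal{C}_{w\le b}$ for some integers $a\le b$. $H^m:\mathcal{C}\to\mathcal{C}^{t=0}$, $m\in\mathbb{Z}$, are the cohomology functors of $t$; $\mathcal{C}^{t=m}=\mathcal{C}^{t=0}[-m]$; bounded $t$-structures are understood in the usual sense (in particular, each object has finitely many non-zero cohomology objects, and an object with vanishing cohomology is zero). Transversality (Bondarko): there are full Abelian semi-simple subcategories $A_i\subset\mathcal{C}$, $i\in\mathbb{Z}$, which together generate $\mathcal{C}$ as a triangulated category, such that $\operatorname{Hom}_{\mathcal{C}}(A_i,A_j[s])=0$ whenever $s<0$, or $s>i-j$, or ($s=0$ and $i\ne j$), and such that $\mathcal{C}^{t=0}$ is the extension-closure of $\bigcup_i A_i$ and $\mathcal{C}_{w=0}$ consists of the objects isomorphic to finite direct sums of objects of the $A_i[-i]$. (Then $A_i=\mathcal{C}^{t=0}\cap\mathcal{C}_{w=i}$.) The radical of $\mathcal{C}$: $\operatorname{rad}_{\mathcal{C}}(M,N)=\{\alpha:M\to N \mid \mathrm{id}_M-\beta\alpha \text{ is an automorphism of } M \text{ for all } \beta:N\to M\}$. *)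

theory Defs
  imports "HOL-Algebra.Chinese_Remainder" "HOL-Algebra.Module"
begin

section \<open>Linear categories and triangulated categories\<close>

text \<open>
  The objects of a category are the elements of the type \<open>'o\<close>; the homomorphisms from \<open>X\<close>
  to \<open>Y\<close> form a module over a commutative base ring with elements of type \<open>'f\<close>.  Modules of
  morphisms belonging to different pairs of objects are not required to be disjoint, so every notion
  below names source and target explicitly.  The translation automorphism and all its powers are
  given together as a strict action of the integers: \<open>shift C n X\<close> is \<open>X[n]\<close>, and
  \<open>shift_mor C n f\<close> is \<open>f[n]\<close>.
\<close>

record ('f, 'o, 'm) tricat =
  Hom :: "'o \<Rightarrow> 'o \<Rightarrow> ('f, 'm) module"
  cmp :: "'m \<Rightarrow> 'm \<Rightarrow> 'm" (infixl \<open>\<bullet>\<index>\<close> 70)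
  ident :: "'o \<Rightarrow> 'm"
  shift :: "int \<Rightarrow> 'o \<Rightarrow> 'o"
  shift_mor :: "int \<Rightarrow> 'm \<Rightarrow> 'm"
  dist_tri :: "'o \<Rightarrow> 'o \<Rightarrow> 'o \<Rightarrow> 'm \<Rightarrow> 'm \<Rightarrow> 'm \<Rightarrow> bool"

abbreviation mor :: "('f, 'o, 'm, 'z) tricat_scheme \<Rightarrow> 'o \<Rightarrow> 'o \<Rightarrow> 'm set"
  where "mor C X Y \<equiv> carrier (Hom C X Y)"

abbreviation zero_mor :: "('f, 'o, 'm, 'z) tricat_scheme \<Rightarrow> 'o \<Rightarrow> 'o \<Rightarrow> 'm"
  where "zero_mor C X Y \<equiv> \<zero>\<^bsub>Hom C X Y\<^esub>"

definition is_iso :: "('f, 'o, 'm, 'z) tricat_scheme \<Rightarrow> 'o \<Rightarrow> 'o \<Rightarrow> 'm \<Rightarrow> bool" where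
  "is_iso C X Y f \<longleftrightarrow> f \<in> mor C X Y \<and>
     (\<exists>g \<in> mor C Y X. g \<bullet>\<^bsub>C\<^esub> f = ident C X \<and> f \<bullet>\<^bsub>C\<^esub> g = ident C Y)"

definition isomorphic :: "('f, 'o, 'm, 'z) tricat_scheme \<Rightarrow> 'o \<Rightarrow> 'o \<Rightarrow> bool" where
  "isomorphic C X Y \<longleftrightarrow> (\<exists>f. is_iso C X Y f)"

text \<open>
  A full subcategory is represented by its set of objects.  The next notion refers to the full
  subcategory on \<open>S\<close>; the ambient category is the case \<open>S = UNIV\<close>.
\<close>

definition zero_object :: "('f, 'o, 'm, 'z) tricat_scheme \<Rightarrow> 'o set \<Rightarrow> 'o \<Rightarrow> bool" where
  "zero_object C S Z \<longleftrightarrow> Z \<in> S \<and>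
     (\<forall>X \<in> S. mor C X Z = {zero_mor C X Z} \<and> mor C Z X = {zero_mor C Z X})"

definition is_biproduct ::
  "('f, 'o, 'm, 'z) tricat_scheme \<Rightarrow> 'o \<Rightarrow> 'o \<Rightarrow> 'o \<Rightarrow> 'm \<Rightarrow> 'm \<Rightarrow> 'm \<Rightarrow> 'm \<Rightarrow> bool" where
  "is_biproduct C X Y B i j p q \<longleftrightarrow>
     i \<in> mor C X B \<and> j \<in> mor C Y B \<and> p \<in> mor C B X \<and> q \<in> mor C B Y \<and>
     p \<bullet>\<^bsub>C\<^esub> i = ident C X \<and> q \<bullet>\<^bsub>C\<^esub> j = ident C Y \<and>
     p \<bullet>\<^bsub>C\<^esub> j = zero_mor C Y X \<and> q \<bullet>\<^bsub>C\<^esub> i = zero_mor C X Y \<and>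
     (i \<bullet>\<^bsub>C\<^esub> p) \<oplus>\<^bsub>Hom C B B\<^esub> (j \<bullet>\<^bsub>C\<^esub> q) = ident C B"

definition direct_factor :: "('f, 'o, 'm, 'z) tricat_scheme \<Rightarrow> 'o \<Rightarrow> 'o \<Rightarrow> bool" where
  "direct_factor C X M \<longleftrightarrow> (\<exists>Y i j p q. is_biproduct C X Y M i j p q)"

locale linear_category =
  fixes F :: "('f, 'r) ring_scheme" and C :: "('f, 'o, 'm, 'z) tricat_scheme" (structure)
  assumes Hom_module: "module F (Hom C X Y)"
    and ident_mor: "ident C X \<in> mor C X X"
    and cmp_mor: "\<lbrakk>f \<in> mor C X Y; g \<in> mor C Y Z\<rbrakk> \<Longrightarrow> g \<bullet> f \<in> mor C X Z"
    and cmp_assoc: "\<lbrakk>f \<in> mor C W X; g \<in> mor C X Y; h \<in> mor C Y Z\<rbrakk> \<Longrightarrow> (h \<bullet> g) \<bullet> f = h \<bullet> (g \<bullet> f)"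
    and ident_left: "f \<in> mor C X Y \<Longrightarrow> ident C Y \<bullet> f = f"
    and ident_right: "f \<in> mor C X Y \<Longrightarrow> f \<bullet> ident C X = f"
    and cmp_add_right: "\<lbrakk>f \<in> mor C X Y; f' \<in> mor C X Y; g \<in> mor C Y Z\<rbrakk> \<Longrightarrow>
      g \<bullet> (f \<oplus>\<^bsub>Hom C X Y\<^esub> f') = (g \<bullet> f) \<oplus>\<^bsub>Hom C X Z\<^esub> (g \<bullet> f')"
    and cmp_add_left: "\<lbrakk>f \<in> mor C X Y; g \<in> mor C Y Z; g' \<in> mor C Y Z\<rbrakk> \<Longrightarrow>
      (g \<oplus>\<^bsub>Hom C Y Z\<^esub> g') \<bullet> f = (g \<bullet> f) \<oplus>\<^bsub>Hom C X Z\<^esub> (g' \<bullet> f)"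
    and cmp_smult_right: "\<lbrakk>a \<in> carrier F; f \<in> mor C X Y; g \<in> mor C Y Z\<rbrakk> \<Longrightarrow>
      g \<bullet> (a \<odot>\<^bsub>Hom C X Y\<^esub> f) = a \<odot>\<^bsub>Hom C X Z\<^esub> (g \<bullet> f)"
    and cmp_smult_left: "\<lbrakk>a \<in> carrier F; f \<in> mor C X Y; g \<in> mor C Y Z\<rbrakk> \<Longrightarrow>
      (a \<odot>\<^bsub>Hom C Y Z\<^esub> g) \<bullet> f = a \<odot>\<^bsub>Hom C X Z\<^esub> (g \<bullet> f)"
    and ex_zero: "\<exists>Z. zero_object C UNIV Z"
    and ex_biproduct: "\<exists>B i j p q. is_biproduct C X Y B i j p q"

text \<open>
  Verdier's axioms.  In \<open>octahedral\<close>, \<open>D\<close>, \<open>E\<close> and \<open>G\<close> are cones of \<open>f\<close>, \<open>g\<close> and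
  \<open>g \<bullet> f\<close>, respectively.
\<close>

locale triangulated_category = linear_category F C
  for F :: "('f, 'r) ring_scheme" and C :: "('f, 'o, 'm, 'z) tricat_scheme" (structure) +
  assumes shift_zero: "shift C 0 X = X"
    and shift_add: "shift C (m + n) X = shift C m (shift C n X)"
    and shift_mor_mor: "f \<in> mor C X Y \<Longrightarrow> shift_mor C n f \<in> mor C (shift C n X) (shift C n Y)"
    and shift_mor_zero: "f \<in> mor C X Y \<Longrightarrow> shift_mor C 0 f = f"
    and shift_mor_shift: "f \<in> mor C X Y \<Longrightarrow> shift_mor C (m + n) f = shift_mor C m (shift_mor C n f)"
    and shift_ident: "shift_mor C n (ident C X) = ident C (shift C n X)"
    and shift_cmp: "\<lbrakk>f \<in> mor C X Y; g \<in> mor C Y Z\<rbrakk> \<Longrightarrow>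
      shift_mor C n (g \<bullet> f) = shift_mor C n g \<bullet> shift_mor C n f"
    and shift_mor_add: "\<lbrakk>f \<in> mor C X Y; g \<in> mor C X Y\<rbrakk> \<Longrightarrow>
      shift_mor C n (f \<oplus>\<^bsub>Hom C X Y\<^esub> g) =
      shift_mor C n f \<oplus>\<^bsub>Hom C (shift C n X) (shift C n Y)\<^esub> shift_mor C n g"
    and shift_mor_smult: "\<lbrakk>a \<in> carrier F; f \<in> mor C X Y\<rbrakk> \<Longrightarrow>
      shift_mor C n (a \<odot>\<^bsub>Hom C X Y\<^esub> f) = a \<odot>\<^bsub>Hom C (shift C n X) (shift C n Y)\<^esub> shift_mor C n f"
    and tri_mor: "dist_tri C X Y Z f g h \<Longrightarrow>
      f \<in> mor C X Y \<and> g \<in> mor C Y Z \<and> h \<in> mor C Z (shift C 1 X)"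
    and tri_iso: "\<lbrakk>dist_tri C X Y Z f g h;
      f' \<in> mor C X' Y'; g' \<in> mor C Y' Z'; h' \<in> mor C Z' (shift C 1 X');
      is_iso C X X' u; is_iso C Y Y' v; is_iso C Z Z' w;
      v \<bullet> f = f' \<bullet> u; w \<bullet> g = g' \<bullet> v; shift_mor C 1 u \<bullet> h = h' \<bullet> w\<rbrakk> \<Longrightarrow>
      dist_tri C X' Y' Z' f' g' h'"
    and tri_ident: "zero_object C UNIV Z \<Longrightarrow>
      dist_tri C X X Z (ident C X) (zero_mor C X Z) (zero_mor C Z (shift C 1 X))"
    and tri_cone: "f \<in> mor C X Y \<Longrightarrow> \<exists>Z g h. dist_tri C X Y Z f g h"
    and tri_rotate: "\<lbrakk>f \<in> mor C X Y; g \<in> mor C Y Z; h \<in> mor C Z (shift C 1 X)\<rbrakk> \<Longrightarrow>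
      dist_tri C X Y Z f g h \<longleftrightarrow>
      dist_tri C Y Z (shift C 1 X) g h (\<ominus>\<^bsub>Hom C (shift C 1 X) (shift C 1 Y)\<^esub> shift_mor C 1 f)"
    and tri_complete: "\<lbrakk>dist_tri C X Y Z f g h; dist_tri C X' Y' Z' f' g' h';
      u \<in> mor C X X'; v \<in> mor C Y Y'; v \<bullet> f = f' \<bullet> u\<rbrakk> \<Longrightarrow>
      \<exists>w \<in> mor C Z Z'. w \<bullet> g = g' \<bullet> v \<and> shift_mor C 1 u \<bullet> h = h' \<bullet> w"
    and octahedral: "\<lbrakk>dist_tri C X Y D f d d'; dist_tri C Y Z E g e e';
      dist_tri C X Z G (g \<bullet> f) c c'\<rbrakk> \<Longrightarrow>
      \<exists>u v. dist_tri C D G E u v (shift_mor C 1 d \<bullet> e') \<and>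
        u \<bullet> d = c \<bullet> g \<and> c' \<bullet> u = d' \<and> v \<bullet> c = e \<and> e' \<bullet> v = shift_mor C 1 f \<bullet> c'"


section \<open>Weight structures\<close>

definition w_le :: "('f, 'o, 'm, 'z) tricat_scheme \<Rightarrow> 'o set \<Rightarrow> int \<Rightarrow> 'o set" where
  "w_le C Wle n = shift C n ` Wle"

definition w_ge :: "('f, 'o, 'm, 'z) tricat_scheme \<Rightarrow> 'o set \<Rightarrow> int \<Rightarrow> 'o set" where
  "w_ge C Wge n = shift C n ` Wge"

locale weight_structure = triangulated_category F C
  for F :: "('f, 'r) ring_scheme" and C :: "('f, 'o, 'm, 'z) tricat_scheme" (structure) +
  fixes Wle Wge :: "'o set"
  assumes Wle_direct_factor: "\<lbrakk>M \<in> Wle; direct_factor C X M\<rbrakk> \<Longrightarrow> X \<in> Wle"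
    and Wge_direct_factor: "\<lbrakk>M \<in> Wge; direct_factor C X M\<rbrakk> \<Longrightarrow> X \<in> Wge"
    and w_le_mono: "w_le C Wle 0 \<subseteq> w_le C Wle 1"
    and w_ge_mono: "w_ge C Wge 1 \<subseteq> w_ge C Wge 0"
    and w_orthogonal: "\<lbrakk>X \<in> w_le C Wle 0; Y \<in> w_ge C Wge 1\<rbrakk> \<Longrightarrow> mor C X Y = {zero_mor C X Y}"
    and w_decomposition: "\<exists>X Y f g h. X \<in> w_le C Wle 0 \<and> Y \<in> w_ge C Wge 1 \<and> dist_tri C X M Y f g h"

locale bounded_weight_structure = weight_structure +
  assumes w_bounded: "\<exists>a b. a \<le> b \<and> M \<in> w_ge C Wge a \<inter> w_le C Wle b"


section \<open>t-structures and cohomology\<close>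

text \<open>Cohomological indexing: \<open>C^{t \<le> n} = C^{t \<le> 0}[-n]\<close> and \<open>C^{t \<ge> n} = C^{t \<ge> 0}[-n]\<close>.\<close>

definition t_le :: "('f, 'o, 'm, 'z) tricat_scheme \<Rightarrow> 'o set \<Rightarrow> int \<Rightarrow> 'o set" where
  "t_le C Tle n = shift C (- n) ` Tle"

definition t_ge :: "('f, 'o, 'm, 'z) tricat_scheme \<Rightarrow> 'o set \<Rightarrow> int \<Rightarrow> 'o set" where
  "t_ge C Tge n = shift C (- n) ` Tge"

locale t_structure = triangulated_category F C
  for F :: "('f, 'r) ring_scheme" and C :: "('f, 'o, 'm, 'z) tricat_scheme" (structure) +
  fixes Tle Tge :: "'o set"
  assumes Tle_iso: "\<lbrakk>X \<in> Tle; isomorphic C X Y\<rbrakk> \<Longrightarrow> Y \<in> Tle"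
    and Tge_iso: "\<lbrakk>X \<in> Tge; isomorphic C X Y\<rbrakk> \<Longrightarrow> Y \<in> Tge"
    and t_le_mono: "t_le C Tle 0 \<subseteq> t_le C Tle 1"
    and t_ge_mono: "t_ge C Tge 1 \<subseteq> t_ge C Tge 0"
    and t_orthogonal: "\<lbrakk>X \<in> t_le C Tle 0; Y \<in> t_ge C Tge 1\<rbrakk> \<Longrightarrow> mor C X Y = {zero_mor C X Y}"
    and t_decomposition: "\<exists>X Y f g h. X \<in> t_le C Tle 0 \<and> Y \<in> t_ge C Tge 1 \<and> dist_tri C X M Y f g h"

locale bounded_t_structure = t_structure +
  assumes t_bounded: "\<exists>a b. a \<le> b \<and> M \<in> t_ge C Tge a \<inter> t_le C Tle b"

definition heart :: "'o set \<Rightarrow> 'o set \<Rightarrow> 'o set" where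
  "heart Tle Tge = Tle \<inter> Tge"

text \<open>
  A choice of truncation triangle \<open>X \<rightarrow> M \<rightarrow> Y \<rightarrow> X[1]\<close> with \<open>X\<close> in \<open>C^{t \<le> n}\<close> and
  \<open>Y\<close> in \<open>C^{t \<ge> n+1}\<close>, stored as \<open>(X, Y, f, g, h)\<close>.  Once these triangles are chosen, the
  truncations of a morphism are determined uniquely by their compatibility with the canonical maps.
\<close>

definition trunc_triangle ::
  "('f, 'o, 'm, 'z) tricat_scheme \<Rightarrow> 'o set \<Rightarrow> 'o set \<Rightarrow> int \<Rightarrow> 'o \<Rightarrow> 'o \<times> 'o \<times> 'm \<times> 'm \<times> 'm" where
  "trunc_triangle C Tle Tge n M =
     (SOME (X, Y, f, g, h). X \<in> t_le C Tle n \<and> Y \<in> t_ge C Tge (n + 1) \<and> dist_tri C X M Y f g h)"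

definition trunc_le :: "('f, 'o, 'm, 'z) tricat_scheme \<Rightarrow> 'o set \<Rightarrow> 'o set \<Rightarrow> int \<Rightarrow> 'o \<Rightarrow> 'o" where
  "trunc_le C Tle Tge n M = (case trunc_triangle C Tle Tge n M of (X, Y, f, g, h) \<Rightarrow> X)"

definition trunc_le_map :: "('f, 'o, 'm, 'z) tricat_scheme \<Rightarrow> 'o set \<Rightarrow> 'o set \<Rightarrow> int \<Rightarrow> 'o \<Rightarrow> 'm" where
  "trunc_le_map C Tle Tge n M = (case trunc_triangle C Tle Tge n M of (X, Y, f, g, h) \<Rightarrow> f)"

definition trunc_ge :: "('f, 'o, 'm, 'z) tricat_scheme \<Rightarrow> 'o set \<Rightarrow> 'o set \<Rightarrow> int \<Rightarrow> 'o \<Rightarrow> 'o" where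
  "trunc_ge C Tle Tge n M = (case trunc_triangle C Tle Tge (n - 1) M of (X, Y, f, g, h) \<Rightarrow> Y)"

definition trunc_ge_map :: "('f, 'o, 'm, 'z) tricat_scheme \<Rightarrow> 'o set \<Rightarrow> 'o set \<Rightarrow> int \<Rightarrow> 'o \<Rightarrow> 'm" where
  "trunc_ge_map C Tle Tge n M = (case trunc_triangle C Tle Tge (n - 1) M of (X, Y, f, g, h) \<Rightarrow> g)"

definition trunc_le_mor ::
  "('f, 'o, 'm, 'z) tricat_scheme \<Rightarrow> 'o set \<Rightarrow> 'o set \<Rightarrow> int \<Rightarrow> 'o \<Rightarrow> 'o \<Rightarrow> 'm \<Rightarrow> 'm" where
  "trunc_le_mor C Tle Tge n M N \<alpha> =
     (THE \<beta>. \<beta> \<in> mor C (trunc_le C Tle Tge n M) (trunc_le C Tle Tge n N) \<and>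
        trunc_le_map C Tle Tge n N \<bullet>\<^bsub>C\<^esub> \<beta> = \<alpha> \<bullet>\<^bsub>C\<^esub> trunc_le_map C Tle Tge n M)"

definition trunc_ge_mor ::
  "('f, 'o, 'm, 'z) tricat_scheme \<Rightarrow> 'o set \<Rightarrow> 'o set \<Rightarrow> int \<Rightarrow> 'o \<Rightarrow> 'o \<Rightarrow> 'm \<Rightarrow> 'm" where
  "trunc_ge_mor C Tle Tge n M N \<alpha> =
     (THE \<beta>. \<beta> \<in> mor C (trunc_ge C Tle Tge n M) (trunc_ge C Tle Tge n N) \<and>
        \<beta> \<bullet>\<^bsub>C\<^esub> trunc_ge_map C Tle Tge n M = trunc_ge_map C Tle Tge n N \<bullet>\<^bsub>C\<^esub> \<alpha>)"

text \<open>The cohomology functors \<open>H^m(M) = H^0(M[m])\<close>, where \<open>H^0 = \<tau>^{\<ge> 0} \<circ> \<tau>^{\<le> 0}\<close>.\<close>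

definition cohom :: "('f, 'o, 'm, 'z) tricat_scheme \<Rightarrow> 'o set \<Rightarrow> 'o set \<Rightarrow> int \<Rightarrow> 'o \<Rightarrow> 'o" where
  "cohom C Tle Tge m M = trunc_ge C Tle Tge 0 (trunc_le C Tle Tge 0 (shift C m M))"

definition cohom_mor ::
  "('f, 'o, 'm, 'z) tricat_scheme \<Rightarrow> 'o set \<Rightarrow> 'o set \<Rightarrow> int \<Rightarrow> 'o \<Rightarrow> 'o \<Rightarrow> 'm \<Rightarrow> 'm" where
  "cohom_mor C Tle Tge m M N \<alpha> =
     trunc_ge_mor C Tle Tge 0
       (trunc_le C Tle Tge 0 (shift C m M)) (trunc_le C Tle Tge 0 (shift C m N))
       (trunc_le_mor C Tle Tge 0 (shift C m M) (shift C m N) (shift_mor C m \<alpha>))"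


section \<open>Abelian semi-simple full subcategories\<close>

text \<open>All notions in this section are relative to the full subcategory on \<open>S\<close>.\<close>

definition is_kernel ::
  "('f, 'o, 'm, 'z) tricat_scheme \<Rightarrow> 'o set \<Rightarrow> 'o \<Rightarrow> 'o \<Rightarrow> 'm \<Rightarrow> 'o \<Rightarrow> 'm \<Rightarrow> bool" where
  "is_kernel C S X Y f K k \<longleftrightarrow> K \<in> S \<and> k \<in> mor C K X \<and> f \<bullet>\<^bsub>C\<^esub> k = zero_mor C K Y \<and>
     (\<forall>W \<in> S. \<forall>g \<in> mor C W X. f \<bullet>\<^bsub>C\<^esub> g = zero_mor C W Y \<longrightarrow>
        (\<exists>!u. u \<in> mor C W K \<and> k \<bullet>\<^bsub>C\<^esub> u = g))"

definition is_cokernel ::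
  "('f, 'o, 'm, 'z) tricat_scheme \<Rightarrow> 'o set \<Rightarrow> 'o \<Rightarrow> 'o \<Rightarrow> 'm \<Rightarrow> 'o \<Rightarrow> 'm \<Rightarrow> bool" where
  "is_cokernel C S X Y f Q q \<longleftrightarrow> Q \<in> S \<and> q \<in> mor C Y Q \<and> q \<bullet>\<^bsub>C\<^esub> f = zero_mor C X Q \<and>
     (\<forall>W \<in> S. \<forall>g \<in> mor C Y W. g \<bullet>\<^bsub>C\<^esub> f = zero_mor C X W \<longrightarrow>
        (\<exists>!u. u \<in> mor C Q W \<and> u \<bullet>\<^bsub>C\<^esub> q = g))"

definition is_monomorphism :: "('f, 'o, 'm, 'z) tricat_scheme \<Rightarrow> 'o set \<Rightarrow> 'o \<Rightarrow> 'o \<Rightarrow> 'm \<Rightarrow> bool" where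
  "is_monomorphism C S X Y f \<longleftrightarrow> f \<in> mor C X Y \<and>
     (\<forall>W \<in> S. \<forall>g \<in> mor C W X. \<forall>h \<in> mor C W X. f \<bullet>\<^bsub>C\<^esub> g = f \<bullet>\<^bsub>C\<^esub> h \<longrightarrow> g = h)"

definition is_epimorphism :: "('f, 'o, 'm, 'z) tricat_scheme \<Rightarrow> 'o set \<Rightarrow> 'o \<Rightarrow> 'o \<Rightarrow> 'm \<Rightarrow> bool" where
  "is_epimorphism C S X Y f \<longleftrightarrow> f \<in> mor C X Y \<and>
     (\<forall>W \<in> S. \<forall>g \<in> mor C Y W. \<forall>h \<in> mor C Y W. g \<bullet>\<^bsub>C\<^esub> f = h \<bullet>\<^bsub>C\<^esub> f \<longrightarrow> g = h)"

definition abelian_subcategory :: "('f, 'o, 'm, 'z) tricat_scheme \<Rightarrow> 'o set \<Rightarrow> bool" where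
  "abelian_subcategory C S \<longleftrightarrow>
     (\<exists>Z. zero_object C S Z) \<and>
     (\<forall>X \<in> S. \<forall>Y \<in> S. \<exists>B \<in> S. \<exists>i j p q. is_biproduct C X Y B i j p q) \<and>
     (\<forall>X \<in> S. \<forall>Y \<in> S. \<forall>f \<in> mor C X Y.
        (\<exists>K k. is_kernel C S X Y f K k) \<and> (\<exists>Q q. is_cokernel C S X Y f Q q)) \<and>
     (\<forall>X \<in> S. \<forall>Y \<in> S. \<forall>f. is_monomorphism C S X Y f \<longrightarrow>
        (\<exists>Z \<in> S. \<exists>g \<in> mor C Y Z. is_kernel C S Y Z g X f)) \<and>
     (\<forall>X \<in> S. \<forall>Y \<in> S. \<forall>f. is_epimorphism C S X Y f \<longrightarrow>
        (\<exists>W \<in> S. \<exists>g \<in> mor C W X. is_cokernel C S W X g Y f))"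

definition short_exact ::
  "('f, 'o, 'm, 'z) tricat_scheme \<Rightarrow> 'o set \<Rightarrow> 'o \<Rightarrow> 'o \<Rightarrow> 'o \<Rightarrow> 'm \<Rightarrow> 'm \<Rightarrow> bool" where
  "short_exact C S X Y Z f g \<longleftrightarrow> X \<in> S \<and> Y \<in> S \<and> Z \<in> S \<and>
     is_kernel C S Y Z g X f \<and> is_cokernel C S X Y f Z g"

text \<open>
  Semi-simple means that every short exact sequence splits.  This covers the definition by
  finite direct sums of simple objects, without imposing that objects have finite length.
\<close>

definition semisimple_subcategory :: "('f, 'o, 'm, 'z) tricat_scheme \<Rightarrow> 'o set \<Rightarrow> bool" where
  "semisimple_subcategory C S \<longleftrightarrow>
     (\<forall>X Y Z f g. short_exact C S X Y Z f g \<longrightarrow> (\<exists>r s. is_biproduct C X Z Y f s r g))"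


section \<open>Transversality\<close>

definition triangulated_subcategory :: "('f, 'o, 'm, 'z) tricat_scheme \<Rightarrow> 'o set \<Rightarrow> bool" where
  "triangulated_subcategory C D \<longleftrightarrow>
     (\<exists>Z \<in> D. zero_object C UNIV Z) \<and>
     (\<forall>X Y. X \<in> D \<and> isomorphic C X Y \<longrightarrow> Y \<in> D) \<and>
     (\<forall>X n. X \<in> D \<longrightarrow> shift C n X \<in> D) \<and>
     (\<forall>X Y Z f g h. dist_tri C X Y Z f g h \<and> X \<in> D \<and> Y \<in> D \<longrightarrow> Z \<in> D)"

definition generates :: "('f, 'o, 'm, 'z) tricat_scheme \<Rightarrow> 'o set \<Rightarrow> bool" where
  "generates C S \<longleftrightarrow> (\<forall>D. triangulated_subcategory C D \<and> S \<subseteq> D \<longrightarrow> D = UNIV)"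

inductive_set extension_closure :: "('f, 'o, 'm, 'z) tricat_scheme \<Rightarrow> 'o set \<Rightarrow> 'o set"
  for C :: "('f, 'o, 'm, 'z) tricat_scheme" and S :: "'o set" where
  base: "X \<in> S \<Longrightarrow> X \<in> extension_closure C S"
| zero: "zero_object C UNIV X \<Longrightarrow> X \<in> extension_closure C S"
| extension: "\<lbrakk>X \<in> extension_closure C S; Z \<in> extension_closure C S; dist_tri C X Y Z f g h\<rbrakk> \<Longrightarrow>
    Y \<in> extension_closure C S"

text \<open>
  The objects isomorphic to finite direct sums of members of \<open>S\<close>.  Zero objects and biproducts
  are only determined up to isomorphism, so this set is closed under isomorphism.
\<close>

inductive_set finite_sums :: "('f, 'o, 'm, 'z) tricat_scheme \<Rightarrow> 'o set \<Rightarrow> 'o set"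
  for C :: "('f, 'o, 'm, 'z) tricat_scheme" and S :: "'o set" where
  empty: "zero_object C UNIV X \<Longrightarrow> X \<in> finite_sums C S"
| step: "\<lbrakk>X \<in> finite_sums C S; Y \<in> S; is_biproduct C X Y B i j p q\<rbrakk> \<Longrightarrow> B \<in> finite_sums C S"

definition transversal ::
  "('f, 'o, 'm, 'z) tricat_scheme \<Rightarrow> 'o set \<Rightarrow> 'o set \<Rightarrow> 'o set \<Rightarrow> 'o set \<Rightarrow> bool" where
  "transversal C Wle Wge Tle Tge \<longleftrightarrow> (\<exists>A :: int \<Rightarrow> 'o set.
     (\<forall>i. abelian_subcategory C (A i) \<and> semisimple_subcategory C (A i)) \<and>
     generates C (\<Union>i. A i) \<and>
     (\<forall>i j s. s < 0 \<or> s > i - j \<or> (s = 0 \<and> i \<noteq> j) \<longrightarrow>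
        (\<forall>X \<in> A i. \<forall>Y \<in> A j. mor C X (shift C s Y) = {zero_mor C X (shift C s Y)})) \<and>
     heart Tle Tge = extension_closure C (\<Union>i. A i) \<and>
     w_le C Wle 0 \<inter> w_ge C Wge 0 = finite_sums C (\<Union>i. shift C (- i) ` A i))"


section \<open>The radical\<close>

definition radical :: "('f, 'o, 'm, 'z) tricat_scheme \<Rightarrow> 'o \<Rightarrow> 'o \<Rightarrow> 'm set" where
  "radical C M N = {\<alpha> \<in> mor C M N.
     \<forall>\<beta> \<in> mor C N M. is_iso C M M (ident C M \<ominus>\<^bsub>Hom C M M\<^esub> \<beta> \<bullet>\<^bsub>C\<^esub> \<alpha>)}"


section \<open>Finite direct products of fields of characteristic zero\<close>

definition char_zero_field :: "('k, 'y) ring_scheme \<Rightarrow> bool" where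
  "char_zero_field K \<longleftrightarrow> field K \<and> (\<forall>n :: nat. n > 0 \<longrightarrow> add_pow K n \<one>\<^bsub>K\<^esub> \<noteq> \<zero>\<^bsub>K\<^esub>)"

definition product_of_char_zero_fields :: "('f, 'r) ring_scheme \<Rightarrow> 'k ring list \<Rightarrow> bool" where
  "product_of_char_zero_fields F Ks \<longleftrightarrow>
     cring F \<and> (\<forall>K \<in> set Ks. char_zero_field K) \<and> F \<simeq> RDirProd_list Ks"

end

theory Submission
  imports Defs
begin

text \<open>
  The vanishing of \<open>H^m(\<alpha>)\<close> means that \<open>v \<circ> \<alpha> \<circ> u = 0\<close> for all \<open>u : X \<rightarrow> M\<close> and \<open>v : N \<rightarrow> Y\<close>
  with \<open>X\<close> in \<open>C^{t \<le> m}\<close> and \<open>Y\<close> in \<open>C^{t \<ge> m}\<close>.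

  If this holds for all \<open>m\<close>, it holds for \<open>\<gamma> = \<beta> \<circ> \<alpha>\<close> as well; such a \<open>\<gamma>\<close> lowers the
  \<open>t\<close>-filtration of \<open>M\<close> and is therefore nilpotent, and \<open>1 - \<gamma>\<close> is inverted by a geometric series.

  Conversely, let \<open>\<alpha>\<close> be radical.  Truncations of \<open>M\<close> and \<open>N\<close> inherit the bounds on the weights,
  so, up to a shift, \<open>\<tau>^{\<le> 0} M \<rightarrow> M \<rightarrow> N \<rightarrow> \<tau>^{\<ge> 0} N\<close> is induced by a morphism from an object of the
  heart of weights \<open>\<ge> k\<close> to one of weights \<open>\<le> k\<close>.  It is determined by the induced
  morphism between the parts of weight \<open>k\<close>, which is again radical because these parts lift to
  \<open>\<tau>^{\<le> 0} M\<close> and \<open>\<tau>^{\<ge> 0} N\<close>.  Semi-simplicity of \<open>A_k\<close> forces it to vanish.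
\<close>

section \<open>Linear categories\<close>

text \<open>The truncations behind \<open>cohom\<close> are picked by \<open>SOME\<close>, so
  nothing is known about their weights. Truncation triangles with weight bounds are therefore built
  separately, one cohomology object at a time. Since \<open>cohom_null\<close> speaks only of test
  maps, it can be checked with either kind of triangle. That cohomology objects inherit weight
  bounds rests on an asymmetry: Hom(A_i, A_j[1]) vanishes for i \<le> j. So in the heart the low
  weights can be collected in a subobject, and maps from the A_i detect this subobject. The common
  bound on M and N leaves k as the only weight shared by the two heart objects; pieces of different
  weights are orthogonal. Semi-simplicity enters as von Neumann regularity: some \<psi> satisfies
  \<phi> \<psi> \<phi> = \<phi>, and this kills a radical \<phi> because 1 - \<psi> \<phi> is
  invertible.\<close>

sublocale linear_category \<subseteq> hom: abelian_group "Hom C X Y" for X Y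
  using Hom_module module.axioms by blast

context linear_category
begin

lemma cmp_zero_right:
  assumes "g \<in> mor C Y Z"
  shows "g \<bullet> zero_mor C X Y = zero_mor C X Z"
proof -
  have c: "g \<bullet> zero_mor C X Y \<in> mor C X Z" using assms cmp_mor hom.zero_closed by blast
  have "(g \<bullet> zero_mor C X Y) \<oplus>\<^bsub>Hom C X Z\<^esub> (g \<bullet> zero_mor C X Y) = g \<bullet> zero_mor C X Y"
    using cmp_add_right[of "zero_mor C X Y" X Y "zero_mor C X Y" g Z] assms by simp
  then show ?thesis using c by (metis hom.add.r_cancel_one)
qed

lemma cmp_zero_left:
  assumes "f \<in> mor C X Y"
  shows "zero_mor C Y Z \<bullet> f = zero_mor C X Z"
proof -
  have c: "zero_mor C Y Z \<bullet> f \<in> mor C X Z" using assms cmp_mor hom.zero_closed by blast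
  have "(zero_mor C Y Z \<bullet> f) \<oplus>\<^bsub>Hom C X Z\<^esub> (zero_mor C Y Z \<bullet> f) = zero_mor C Y Z \<bullet> f"
    using cmp_add_left[of f X Y "zero_mor C Y Z" Z "zero_mor C Y Z"] assms by simp
  then show ?thesis using c by (metis hom.add.r_cancel_one)
qed

lemma cmp_uminus_right:
  assumes "f \<in> mor C X Y" "g \<in> mor C Y Z"
  shows "g \<bullet> (\<ominus>\<^bsub>Hom C X Y\<^esub> f) = \<ominus>\<^bsub>Hom C X Z\<^esub> (g \<bullet> f)"
proof -
  have "(g \<bullet> (\<ominus>\<^bsub>Hom C X Y\<^esub> f)) \<oplus>\<^bsub>Hom C X Z\<^esub> (g \<bullet> f) = zero_mor C X Z"
    using cmp_add_right[of "\<ominus>\<^bsub>Hom C X Y\<^esub> f" X Y f g Z] assms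
    by (simp add: hom.l_neg cmp_zero_right)
  then show ?thesis using assms by (metis cmp_mor hom.minus_equality hom.a_inv_closed)
qed

lemma cmp_uminus_left:
  assumes "f \<in> mor C X Y" "g \<in> mor C Y Z"
  shows "(\<ominus>\<^bsub>Hom C Y Z\<^esub> g) \<bullet> f = \<ominus>\<^bsub>Hom C X Z\<^esub> (g \<bullet> f)"
proof -
  have "((\<ominus>\<^bsub>Hom C Y Z\<^esub> g) \<bullet> f) \<oplus>\<^bsub>Hom C X Z\<^esub> (g \<bullet> f) = zero_mor C X Z"
    using cmp_add_left[of f X Y "\<ominus>\<^bsub>Hom C Y Z\<^esub> g" Z g] assms
    by (simp add: hom.l_neg cmp_zero_left)
  then show ?thesis using assms by (metis cmp_mor hom.minus_equality hom.a_inv_closed)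
qed

lemma cmp_minus_right:
  assumes "f \<in> mor C X Y" "f' \<in> mor C X Y" "g \<in> mor C Y Z"
  shows "g \<bullet> (f \<ominus>\<^bsub>Hom C X Y\<^esub> f') = (g \<bullet> f) \<ominus>\<^bsub>Hom C X Z\<^esub> (g \<bullet> f')"
  using assms by (simp add: a_minus_def cmp_add_right cmp_uminus_right)

lemma cmp_minus_left:
  assumes "f \<in> mor C X Y" "g \<in> mor C Y Z" "g' \<in> mor C Y Z"
  shows "(g \<ominus>\<^bsub>Hom C Y Z\<^esub> g') \<bullet> f = (g \<bullet> f) \<ominus>\<^bsub>Hom C X Z\<^esub> (g' \<bullet> f)"
  using assms by (simp add: a_minus_def cmp_add_left cmp_uminus_left)

lemma uminus_zero_mor: "\<ominus>\<^bsub>Hom C X Y\<^esub> zero_mor C X Y = zero_mor C X Y"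
  by (rule hom.minus_equality) simp_all

lemma minus_zero_iff:
  assumes "f \<in> mor C X Y" "g \<in> mor C X Y"
  shows "f \<ominus>\<^bsub>Hom C X Y\<^esub> g = zero_mor C X Y \<longleftrightarrow> f = g"
  proof
  assume "f \<ominus>\<^bsub>Hom C X Y\<^esub> g = zero_mor C X Y"
  then have "\<ominus>\<^bsub>Hom C X Y\<^esub> (\<ominus>\<^bsub>Hom C X Y\<^esub> g) = f"
    using assms by (intro hom.minus_equality) (simp_all add: a_minus_def)
  then show "f = g" using assms by simp
qed (use assms in \<open>simp add: a_minus_def hom.r_neg\<close>)

lemma zero_object_iff: "zero_object C UNIV Z \<longleftrightarrow> ident C Z = zero_mor C Z Z"
proof
  assume "zero_object C UNIV Z"
  then show "ident C Z = zero_mor C Z Z" using ident_mor[of Z] by (auto simp: zero_object_def)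
next
  assume e: "ident C Z = zero_mor C Z Z"
  have "f = zero_mor C X Z" if "f \<in> mor C X Z" for X f
    using that e ident_left cmp_zero_left by metis
  moreover have "f = zero_mor C Z X" if "f \<in> mor C Z X" for X f
    using that e ident_right cmp_zero_right by metis
  ultimately show "zero_object C UNIV Z" by (auto simp: zero_object_def)
qed

definition orth :: "'o \<Rightarrow> 'o \<Rightarrow> bool" where
  "orth X Y \<longleftrightarrow> (\<forall>f \<in> mor C X Y. f = zero_mor C X Y)"

lemma orth_iff: "orth X Y \<longleftrightarrow> mor C X Y = {zero_mor C X Y}"
  by (auto simp: orth_def)

lemma orthD: "\<lbrakk>orth X Y; f \<in> mor C X Y\<rbrakk> \<Longrightarrow> f = zero_mor C X Y"
  by (simp add: orth_def)

lemma orth_self_iff: "orth X X \<longleftrightarrow> zero_object C UNIV X"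
  using ident_mor[of X] by (auto simp: orth_def zero_object_iff[of X]) (metis cmp_zero_left ident_left)

lemma orth_zero_left: "zero_object C UNIV Z \<Longrightarrow> orth Z X"
  and orth_zero_right: "zero_object C UNIV Z \<Longrightarrow> orth X Z"
  by (auto simp: orth_def zero_object_def)

end

section \<open>Exact triangles\<close>

context triangulated_category
begin

lemma shift_shift [simp]: "shift C m (shift C n X) = shift C (m + n) X"
  by (simp add: shift_add)

lemma shift_0 [simp]: "shift C 0 X = X"
  by (rule shift_zero)

lemma shift_mor_zero_mor: "shift_mor C n (zero_mor C X Y) = zero_mor C (shift C n X) (shift C n Y)"
proof -
  let ?z = "shift_mor C n (zero_mor C X Y)"
  have c: "?z \<in> mor C (shift C n X) (shift C n Y)" by (simp add: shift_mor_mor)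
  have "?z \<oplus>\<^bsub>Hom C (shift C n X) (shift C n Y)\<^esub> ?z = ?z"
    using shift_mor_add[of "zero_mor C X Y" X Y "zero_mor C X Y" n] by simp
  then show ?thesis using c by (metis hom.add.r_cancel_one)
qed

lemma shift_mor_uminus:
  assumes "f \<in> mor C X Y"
  shows "shift_mor C n (\<ominus>\<^bsub>Hom C X Y\<^esub> f) = \<ominus>\<^bsub>Hom C (shift C n X) (shift C n Y)\<^esub> shift_mor C n f"
proof -
  have "shift_mor C n (\<ominus>\<^bsub>Hom C X Y\<^esub> f) \<oplus>\<^bsub>Hom C (shift C n X) (shift C n Y)\<^esub> shift_mor C n f =
      zero_mor C (shift C n X) (shift C n Y)"
    using shift_mor_add[of "\<ominus>\<^bsub>Hom C X Y\<^esub> f" X Y f n] assms by (simp add: hom.l_neg shift_mor_zero_mor)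
  then show ?thesis using assms by (metis shift_mor_mor hom.minus_equality hom.a_inv_closed)
qed

lemma shift_mor_minus:
  assumes "f \<in> mor C X Y" "g \<in> mor C X Y"
  shows "shift_mor C n (f \<ominus>\<^bsub>Hom C X Y\<^esub> g) =
    shift_mor C n f \<ominus>\<^bsub>Hom C (shift C n X) (shift C n Y)\<^esub> shift_mor C n g"
  using assms by (simp add: a_minus_def shift_mor_add shift_mor_uminus)

lemma shift_mor_inverse:
  assumes "f \<in> mor C X Y" "m + n = 0"
  shows "shift_mor C m (shift_mor C n f) = f"
  using assms by (metis shift_mor_shift shift_mor_zero)

lemma shift_mor_surj:
  assumes "f \<in> mor C (shift C n X) (shift C n Y)"
  obtains g where "g \<in> mor C X Y" "shift_mor C n g = f"
proof
  show "shift_mor C (- n) f \<in> mor C X Y" using shift_mor_mor[OF assms, of "- n"] by simp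
  show "shift_mor C n (shift_mor C (- n) f) = f" using shift_mor_inverse[OF assms] by simp
qed

lemma shift_mor_inj:
  assumes "f \<in> mor C X Y" "g \<in> mor C X Y" "shift_mor C n f = shift_mor C n g"
  shows "f = g"
  using assms shift_mor_inverse[of _ X Y "- n" n] by (metis add.left_inverse)

lemma orth_shift: "orth (shift C n X) (shift C n Y) \<longleftrightarrow> orth X Y"
proof
  assume o: "orth (shift C n X) (shift C n Y)"
  show "orth X Y" unfolding orth_def
  proof
    fix f assume f: "f \<in> mor C X Y"
    then have "shift_mor C n f = shift_mor C n (zero_mor C X Y)"
      using orthD[OF o shift_mor_mor[OF f]] by (simp add: shift_mor_zero_mor)
    then show "f = zero_mor C X Y" using shift_mor_inj[OF f hom.zero_closed] by blast
  qed
next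
  assume o: "orth X Y"
  show "orth (shift C n X) (shift C n Y)" unfolding orth_def
  proof
    fix f assume "f \<in> mor C (shift C n X) (shift C n Y)"
    then obtain g where "g \<in> mor C X Y" "shift_mor C n g = f" by (rule shift_mor_surj)
    then show "f = zero_mor C (shift C n X) (shift C n Y)"
      using orthD[OF o] shift_mor_zero_mor by blast
  qed
qed

lemma zero_object_shift: "zero_object C UNIV X \<Longrightarrow> zero_object C UNIV (shift C n X)"
  using orth_shift[of n X X] by (simp add: orth_self_iff)

lemma tri_rotate_left:
  assumes "dist_tri C X Y Z f g h"
  shows "dist_tri C Y Z (shift C 1 X) g h (\<ominus>\<^bsub>Hom C (shift C 1 X) (shift C 1 Y)\<^esub> shift_mor C 1 f)"
  using assms tri_mor[OF assms] tri_rotate by blast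

text \<open>The rotation axiom read backwards. The first map carries a sign because
  \<open>tri_rotate\<close> shifts and negates it, and the two signs must cancel to return
  \<open>h\<close>.\<close>

lemma tri_rotate_right:
  assumes "dist_tri C X Y Z f g h"
  shows "dist_tri C (shift C (- 1) Z) X Y
    (\<ominus>\<^bsub>Hom C (shift C (- 1) Z) X\<^esub> shift_mor C (- 1) h) f g"
proof -
  let ?k = "\<ominus>\<^bsub>Hom C (shift C (- 1) Z) X\<^esub> shift_mor C (- 1) h"
  have m: "f \<in> mor C X Y" "g \<in> mor C Y Z" "h \<in> mor C Z (shift C 1 X)" using tri_mor[OF assms] by auto
  have h': "shift_mor C (- 1) h \<in> mor C (shift C (- 1) Z) X"
    using shift_mor_mor[OF m(3), of "- 1"] by simp
  have "shift_mor C 1 ?k = \<ominus>\<^bsub>Hom C Z (shift C 1 X)\<^esub> h"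
    using shift_mor_uminus[OF h', of 1] shift_mor_inverse[OF m(3), of 1 "- 1"] by simp
  then have "\<ominus>\<^bsub>Hom C (shift C 1 (shift C (- 1) Z)) (shift C 1 X)\<^esub> shift_mor C 1 ?k = h"
    using m(3) by simp
  then show ?thesis
    using tri_rotate[of ?k "shift C (- 1) Z" X f Y g] h' m assms by simp
qed

lemma tri_ident_left:
  assumes "zero_object C UNIV Z"
  shows "dist_tri C Z X X (zero_mor C Z X) (ident C X) (zero_mor C X (shift C 1 Z))"
  using tri_ident[OF zero_object_shift[OF assms, of 1], of X]
    tri_rotate[of "zero_mor C Z X" Z X "ident C X" X "zero_mor C X (shift C 1 Z)"] ident_mor
  by (simp add: shift_mor_zero_mor uminus_zero_mor)

text \<open>The triangle on \<open>ident C X\<close> maps to the given one by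
  \<open>ident C X\<close> and \<open>f\<close>, and the third map shows that the composite factors
  through a zero object.\<close>

lemma tri_cmp_zero:
  assumes "dist_tri C X Y Z f g h"
  shows "g \<bullet> f = zero_mor C X Z"
proof -
  obtain O0 where O: "zero_object C UNIV O0" using ex_zero by blast
  have m: "f \<in> mor C X Y" "g \<in> mor C Y Z" using tri_mor[OF assms] by auto
  obtain w where w: "w \<in> mor C O0 Z" "w \<bullet> zero_mor C X O0 = g \<bullet> f"
    using tri_complete[OF tri_ident[OF O, of X] assms ident_mor m(1)] by blast
  then show ?thesis using cmp_zero_right by metis
qed

text \<open>\<open>f\<close> is a weak kernel of \<open>g\<close>. The axiom
  \<open>tri_complete\<close> only supplies a third map, so both triangles are rotated until the
  sought map is the third one; the result is then shifted back.\<close>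

lemma tri_lift:
  assumes t: "dist_tri C X Y Z f g h" and u: "u \<in> mor C W Y" "g \<bullet> u = zero_mor C W Z"
  obtains u' where "u' \<in> mor C W X" "f \<bullet> u' = u"
proof -
  obtain O0 where O: "zero_object C UNIV O0" using ex_zero by blast
  have m: "f \<in> mor C X Y" "g \<in> mor C Y Z" using tri_mor[OF t] by auto
  obtain w where w: "w \<in> mor C (shift C 1 W) (shift C 1 X)"
    and e: "shift_mor C 1 u \<bullet> (\<ominus>\<^bsub>Hom C (shift C 1 W) (shift C 1 W)\<^esub> shift_mor C 1 (ident C W)) =
      (\<ominus>\<^bsub>Hom C (shift C 1 X) (shift C 1 Y)\<^esub> shift_mor C 1 f) \<bullet> w"
    using tri_complete[OF tri_rotate_left[OF tri_ident[OF O, of W]] tri_rotate_left[OF t] u(1), of "zero_mor C O0 Z"]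
      u(2) cmp_zero_left[of "zero_mor C W O0" W O0 Z] by auto
  have u1: "shift_mor C 1 u \<in> mor C (shift C 1 W) (shift C 1 Y)" using u shift_mor_mor by blast
  have f1: "shift_mor C 1 f \<in> mor C (shift C 1 X) (shift C 1 Y)" using m shift_mor_mor by blast
  have "\<ominus>\<^bsub>Hom C (shift C 1 W) (shift C 1 Y)\<^esub> shift_mor C 1 u =
      \<ominus>\<^bsub>Hom C (shift C 1 W) (shift C 1 Y)\<^esub> (shift_mor C 1 f \<bullet> w)"
    using e w u1 f1 ident_mor by (simp add: shift_ident cmp_uminus_right cmp_uminus_left ident_right)
  then have e1: "shift_mor C 1 u = shift_mor C 1 f \<bullet> w"
    using u1 f1 w cmp_mor by (metis hom.minus_minus)
  obtain u' where u': "u' \<in> mor C W X" "shift_mor C 1 u' = w" using w shift_mor_surj by blast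
  have "shift_mor C 1 (f \<bullet> u') = shift_mor C 1 u" using e1 u' m shift_cmp by metis
  then have "f \<bullet> u' = u" using shift_mor_inj u' m u(1) cmp_mor by metis
  then show thesis using that u' by blast
qed

text \<open>Dual to \<open>tri_lift\<close>, but the sought map already is the third component of a
  morphism to the triangle 0 -> W -> W.\<close>

lemma tri_extend:
  assumes t: "dist_tri C X Y Z f g h" and v: "v \<in> mor C Y W" "v \<bullet> f = zero_mor C X W"
  obtains v' where "v' \<in> mor C Z W" "v' \<bullet> g = v"
proof -
  obtain O0 where O: "zero_object C UNIV O0" using ex_zero by blast
  obtain w where "w \<in> mor C Z W" "w \<bullet> g = ident C W \<bullet> v"
    using tri_complete[OF t tri_ident_left[OF O, of W], of "zero_mor C X O0" v]
      v cmp_zero_right[of "zero_mor C O0 W" O0 W X] by auto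
  then show thesis using that v ident_left by metis
qed

lemma tri_lift_orth:
  assumes "dist_tri C X Y Z f g h" "u \<in> mor C W Y" "orth W Z"
  obtains u' where "u' \<in> mor C W X" "f \<bullet> u' = u"
proof (rule tri_lift[OF assms(1,2)])
  show "g \<bullet> u = zero_mor C W Z" using orthD[OF assms(3)] cmp_mor[OF assms(2)] tri_mor[OF assms(1)] by blast
qed (use that in blast)

lemma tri_extend_orth:
  assumes "dist_tri C X Y Z f g h" "v \<in> mor C Y W" "orth X W"
  obtains v' where "v' \<in> mor C Z W" "v' \<bullet> g = v"
proof (rule tri_extend[OF assms(1,2)])
  show "v \<bullet> f = zero_mor C X W" using orthD[OF assms(3)] cmp_mor[OF _ assms(2)] tri_mor[OF assms(1)] by blast
qed (use that in blast)

text \<open>The difference of \<open>u\<close> and \<open>u'\<close> is killed by \<open>f\<close>,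
  so it comes from \<open>shift C (- 1) Z\<close>, which receives no map from \<open>W\<close>. This
  yields the uniqueness half of the universal property of truncations.\<close>

lemma tri_mono:
  assumes t: "dist_tri C X Y Z f g h" and o: "orth W (shift C (- 1) Z)"
    and u: "u \<in> mor C W X" "u' \<in> mor C W X" "f \<bullet> u = f \<bullet> u'"
  shows "u = u'"
proof -
  have m: "f \<in> mor C X Y" using tri_mor[OF t] by auto
  let ?d = "u \<ominus>\<^bsub>Hom C W X\<^esub> u'"
  have d: "?d \<in> mor C W X" using u by simp
  have "f \<bullet> ?d = zero_mor C W Y"
    using u m cmp_minus_right minus_zero_iff cmp_mor by metis
  from tri_lift[OF tri_rotate_right[OF t] d this]
  obtain e where "e \<in> mor C W (shift C (- 1) Z)"
    "(\<ominus>\<^bsub>Hom C (shift C (- 1) Z) X\<^esub> shift_mor C (- 1) h) \<bullet> e = ?d" by blast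
  then have "?d = zero_mor C W X"
    using orthD[OF o] tri_mor[OF tri_rotate_right[OF t]] cmp_zero_right by metis
  then show ?thesis using u minus_zero_iff by metis
qed

lemma tri_epi:
  assumes t: "dist_tri C X Y Z f g h" and o: "orth (shift C 1 X) W"
    and u: "u \<in> mor C Z W" "u' \<in> mor C Z W" "u \<bullet> g = u' \<bullet> g"
  shows "u = u'"
proof -
  have m: "g \<in> mor C Y Z" using tri_mor[OF t] by auto
  let ?d = "u \<ominus>\<^bsub>Hom C Z W\<^esub> u'"
  have d: "?d \<in> mor C Z W" using u by simp
  have "?d \<bullet> g = zero_mor C Y W"
    using u m cmp_minus_left minus_zero_iff cmp_mor by metis
  from tri_extend[OF tri_rotate_left[OF t] d this]
  obtain e where "e \<in> mor C (shift C 1 X) W" "e \<bullet> h = ?d" by blast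
  then have "?d = zero_mor C Z W"
    using orthD[OF o] tri_mor[OF t] cmp_zero_left by metis
  then show ?thesis using u minus_zero_iff by metis
qed

end

section \<open>Extensions\<close>

context linear_category
begin

lemma is_biproduct_swap:
  assumes "is_biproduct C X Y B i j p q"
  shows "is_biproduct C Y X B j i q p"
proof -
  have "i \<bullet> p \<in> mor C B B" "j \<bullet> q \<in> mor C B B"
    using assms cmp_mor unfolding is_biproduct_def by blast+
  then show ?thesis using assms unfolding is_biproduct_def by (simp add: hom.a_comm)
qed

lemma direct_factors_biproduct:
  assumes "is_biproduct C X Y B i j p q"
  shows "direct_factor C X B" "direct_factor C Y B"
  using assms is_biproduct_swap unfolding direct_factor_def by blast+

end

context triangulated_category
begin

text \<open>Lifting the identity of \<open>Z\<close> and extending that of \<open>X\<close> gives a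
  section and a retraction, which need not be compatible with each other; the section is corrected
  below.\<close>

lemma split_triangle:
  assumes t: "dist_tri C X Y Z f g (zero_mor C Z (shift C 1 X))"
  shows "\<exists>r s. is_biproduct C X Z Y f s r g"
proof -
  have m: "f \<in> mor C X Y" "g \<in> mor C Y Z" using tri_mor[OF t] by auto
  obtain s where s: "s \<in> mor C Z Y" "g \<bullet> s = ident C Z"
    by (rule tri_lift[OF tri_rotate_left[OF t] ident_mor]) (use cmp_zero_left[OF ident_mor] in blast)+
  have z: "shift_mor C (- 1) (zero_mor C Z (shift C 1 X)) = zero_mor C (shift C (- 1) Z) X"
    using shift_mor_zero_mor[of "- 1" Z "shift C 1 X"] by simp
  have t': "dist_tri C (shift C (- 1) Z) X Y (zero_mor C (shift C (- 1) Z) X) f g"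
    using tri_rotate_right[OF t] by (simp add: z uminus_zero_mor)
  obtain r where r: "r \<in> mor C Y X" "r \<bullet> f = ident C X"
    by (rule tri_extend[OF t' ident_mor]) (use cmp_zero_right[OF ident_mor] in blast)+
  \<comment> \<open>Removing the component along \<open>f\<close> makes \<open>r\<close> vanish on
    the section and keeps it a section, since g f = 0.\<close>
  let ?s = "s \<ominus>\<^bsub>Hom C Z Y\<^esub> f \<bullet> (r \<bullet> s)"
  note [simp] = cmp_mor[OF r(1) m(1)] cmp_mor[OF s(1) r(1)] cmp_mor[OF s(1) m(2)]
  have frs: "f \<bullet> (r \<bullet> s) \<in> mor C Z Y" using cmp_mor m r s by meson
  have s': "?s \<in> mor C Z Y" using frs s by simp
  have gf: "g \<bullet> f = zero_mor C X Z" by (rule tri_cmp_zero[OF t])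
  have "g \<bullet> (f \<bullet> (r \<bullet> s)) = zero_mor C Z Z"
    using cmp_assoc[OF cmp_mor[OF s(1) r(1)] m] gf cmp_zero_left[OF cmp_mor[OF s(1) r(1)]] by simp
  then have gs: "g \<bullet> ?s = ident C Z"
    using cmp_minus_right[OF s(1) frs m(2)] s ident_mor by (simp add: a_minus_def uminus_zero_mor)
  have "r \<bullet> (f \<bullet> (r \<bullet> s)) = r \<bullet> s"
    using cmp_assoc[OF cmp_mor[OF s(1) r(1)] m(1) r(1)] r ident_left[OF cmp_mor[OF s(1) r(1)]] by simp
  then have rs: "r \<bullet> ?s = zero_mor C Z X"
    using cmp_minus_right[OF s(1) frs r(1)] minus_zero_iff[of "r \<bullet> s" Z X "r \<bullet> s"] by simp
  let ?sg = "?s \<bullet> g" and ?fr = "f \<bullet> r"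
  have sg: "?sg \<in> mor C Y Y" "?fr \<in> mor C Y Y" using cmp_mor s' m r by blast+
  \<comment> \<open>The defect of the biproduct identity is killed by \<open>g\<close>, hence of the
    form f e'; applying \<open>r\<close> then gives e' = 0.\<close>
  let ?e = "ident C Y \<ominus>\<^bsub>Hom C Y Y\<^esub> (?fr \<oplus>\<^bsub>Hom C Y Y\<^esub> ?sg)"
  have e: "?e \<in> mor C Y Y" using sg ident_mor by simp
  have "g \<bullet> ?fr = zero_mor C Y Z" using cmp_assoc[OF r(1) m] gf cmp_zero_left[OF r(1)] by simp
  moreover have "g \<bullet> ?sg = g" using cmp_assoc[OF m(2) s' m(2)] gs ident_left[OF m(2)] by simp
  ultimately have "g \<bullet> ?e = zero_mor C Y Z"
    using cmp_minus_right[OF ident_mor hom.a_closed[OF sg(2) sg(1)] m(2)] cmp_add_right[OF sg(2) sg(1) m(2)]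
      ident_right[OF m(2)] minus_zero_iff[OF m(2) m(2)] m(2) by simp
  from tri_lift[OF t e this] obtain e' where e': "e' \<in> mor C Y X" "f \<bullet> e' = ?e" by blast
  have "r \<bullet> ?fr = r" using cmp_assoc[OF r(1) m(1) r(1)] r ident_left[OF r(1)] by simp
  moreover have "r \<bullet> ?sg = zero_mor C Y X" using cmp_assoc[OF m(2) s' r(1)] rs cmp_zero_left[OF m(2)] by simp
  ultimately have "r \<bullet> ?e = zero_mor C Y X"
    using cmp_minus_right[OF ident_mor hom.a_closed[OF sg(2) sg(1)] r(1)] cmp_add_right[OF sg(2) sg(1) r(1)]
      ident_right[OF r(1)] minus_zero_iff[OF r(1) r(1)] r(1) by simp
  moreover have "r \<bullet> ?e = e'"
    using cmp_assoc[OF e'(1) m(1) r(1)] e' r ident_left[OF e'(1)] by simp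
  ultimately have "?e = zero_mor C Y Y" using e' cmp_zero_right[OF m(1)] by metis
  then have "?fr \<oplus>\<^bsub>Hom C Y Y\<^esub> ?sg = ident C Y"
    using minus_zero_iff[OF ident_mor hom.a_closed[OF sg(2) sg(1)]] by simp
  then show ?thesis using m r s' gs rs gf unfolding is_biproduct_def by blast
qed

text \<open>Forgetting the maps removes all signs from rotations and shifts; closure and
  orthogonality arguments only use that some triangle exists.\<close>

definition is_extension :: "'o \<Rightarrow> 'o \<Rightarrow> 'o \<Rightarrow> bool" where
  "is_extension X Y Z \<longleftrightarrow> (\<exists>f g h. dist_tri C X Y Z f g h)"

lemma is_extensionI: "dist_tri C X Y Z f g h \<Longrightarrow> is_extension X Y Z"
  by (auto simp: is_extension_def)

lemma is_extensionE:
  assumes "is_extension X Y Z"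
  obtains f g h where "dist_tri C X Y Z f g h"
  using assms by (auto simp: is_extension_def)

lemma is_extension_rotate_left: "is_extension X Y Z \<Longrightarrow> is_extension Y Z (shift C 1 X)"
  unfolding is_extension_def using tri_rotate_left by blast

lemma is_extension_rotate_right: "is_extension X Y Z \<Longrightarrow> is_extension (shift C (- 1) Z) X Y"
  unfolding is_extension_def using tri_rotate_right by blast

text \<open>Three rotations shift a triangle by one, and their signs are absorbed by the existential
  quantifier; integer induction gives the other shifts.\<close>

lemma is_extension_shift:
  assumes "is_extension X Y Z"
  shows "is_extension (shift C n X) (shift C n Y) (shift C n Z)"
proof -
  have up: "is_extension (shift C 1 X) (shift C 1 Y) (shift C 1 Z)" if "is_extension X Y Z" for X Y Z
    using that is_extension_rotate_left by blast
  have down: "is_extension (shift C (- 1) X) (shift C (- 1) Y) (shift C (- 1) Z)" if "is_extension X Y Z" for X Y Z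
    using that is_extension_rotate_right by blast
  show ?thesis
  proof (induction n rule: int_induct[where k = 0])
    case base
    then show ?case using assms by simp
  next
    case (step1 i)
    then show ?case using up[OF step1.IH] by (simp add: add.commute)
  next
    case (step2 i)
    then show ?case using down[OF step2.IH] by simp
  qed
qed

lemma is_extension_zero_left: "zero_object C UNIV Z \<Longrightarrow> is_extension Z X X"
  using tri_ident_left is_extensionI by blast

lemma is_extension_zero_right: "zero_object C UNIV Z \<Longrightarrow> is_extension X X Z"
  using tri_ident is_extensionI by blast

lemma orth_extension_left:
  assumes "is_extension X Y Z" "orth X W" "orth Z W"
  shows "orth Y W"
  unfolding orth_def
proof
  fix v assume v: "v \<in> mor C Y W"
  obtain f g h where t: "dist_tri C X Y Z f g h" using assms is_extensionE by blast
  obtain v' where "v' \<in> mor C Z W" "v' \<bullet> g = v" using tri_extend_orth[OF t v assms(2)] by blast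
  then show "v = zero_mor C Y W"
    using orthD[OF assms(3)] cmp_zero_left[of g Y Z W] tri_mor[OF t] by auto
qed

lemma orth_extension_right:
  assumes "is_extension X Y Z" "orth W X" "orth W Z"
  shows "orth W Y"
  unfolding orth_def
proof
  fix v assume v: "v \<in> mor C W Y"
  obtain f g h where t: "dist_tri C X Y Z f g h" using assms is_extensionE by blast
  obtain v' where "v' \<in> mor C W X" "f \<bullet> v' = v" using tri_lift_orth[OF t v assms(3)] by blast
  then show "v = zero_mor C W Y"
    using orthD[OF assms(2)] cmp_zero_right[of f X Y W] tri_mor[OF t] by auto
qed

section \<open>Rearranging filtrations with the octahedral axiom\<close>

lemma octahedron:
  assumes "dist_tri C X Y D f d d'" "dist_tri C Y Z E g e e'" "dist_tri C X Z G (g \<bullet> f) c c'"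
  shows "is_extension D G E"
  using octahedral[OF assms] is_extensionI by blast

lemma is_extension_shiftD:
  assumes "is_extension (shift C n X) (shift C n Y) (shift C n Z)"
  shows "is_extension X Y Z"
  using is_extension_shift[OF assms, of "- n"] by simp

text \<open>With \<open>Z1\<close> seen as a subobject of the quotient \<open>Z\<close> of
  \<open>Y\<close>, \<open>K\<close> is its preimage: the fibre of the composite Y -> Z -> Z2. The
  octahedral axiom is applied to rotated triangles, hence the shift by one.\<close>

lemma ex_middle_left:
  assumes "is_extension X Y Z" "is_extension Z1 Z Z2"
  obtains K where "is_extension X K Z1" "is_extension K Y Z2"
proof -
  obtain f g h f' g' h' where t: "dist_tri C X Y Z f g h" "dist_tri C Z1 Z Z2 f' g' h'"
    using assms is_extensionE by metis
  have "g' \<bullet> g \<in> mor C Y Z2" using tri_mor[OF t(1)] tri_mor[OF t(2)] cmp_mor by blast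
  then obtain G c c' where G: "dist_tri C Y Z2 G (g' \<bullet> g) c c'" using tri_cone by blast
  let ?K = "shift C (- 1) G"
  have "is_extension (shift C 1 X) (shift C 1 ?K) (shift C 1 Z1)"
    using octahedron[OF tri_rotate_left[OF t(1)] tri_rotate_left[OF t(2)] G] by simp
  moreover have "is_extension ?K Y Z2" using is_extension_rotate_right[OF is_extensionI[OF G]] .
  ultimately show thesis using that is_extension_shiftD by blast
qed

text \<open>The dual picture: \<open>G\<close> is the quotient of \<open>Y\<close> by
  \<open>X1\<close>, that is, the cone of X1 -> X -> Y.\<close>

lemma ex_middle_right:
  assumes "is_extension X Y Z" "is_extension X1 X X2"
  obtains G where "is_extension X1 Y G" "is_extension X2 G Z"
proof -
  obtain f g h f' g' h' where t: "dist_tri C X Y Z f g h" "dist_tri C X1 X X2 f' g' h'"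
    using assms is_extensionE by metis
  have "f \<bullet> f' \<in> mor C X1 Y" using tri_mor[OF t(1)] tri_mor[OF t(2)] cmp_mor by blast
  then obtain G c c' where G: "dist_tri C X1 Y G (f \<bullet> f') c c'" using tri_cone by blast
  show thesis using that[OF is_extensionI[OF G]] octahedron[OF t(2) t(1) G] by blast
qed

lemma ex_middle_swap:
  assumes "is_extension X K Z" "is_extension X1 X X2" "orth Z (shift C 1 X2)"
  obtains P where "is_extension X1 P Z" "is_extension P K X2"
proof -
  obtain f g h where t: "dist_tri C X K Z f g h" using assms is_extensionE by metis
  obtain f' g' h' where t': "dist_tri C (shift C 1 X1) (shift C 1 X) (shift C 1 X2) f' g' h'"
    using is_extension_shift[OF assms(2)] is_extensionE by blast
  have h: "h \<in> mor C Z (shift C 1 X)" using tri_mor[OF t] by blast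
  obtain e where e: "e \<in> mor C Z (shift C 1 X1)" "f' \<bullet> e = h"
    by (rule tri_lift_orth[OF t' h assms(3)])
  obtain D d d' where D: "dist_tri C Z (shift C 1 X1) D e d d'" using tri_cone[OF e(1)] by blast
  let ?P = "shift C (- 1) D"
  have "is_extension (shift C 1 ?P) (shift C 1 K) (shift C 1 X2)"
    using octahedron[OF D t'] tri_rotate_left[OF tri_rotate_left[OF t]] e(2) by simp
  moreover have "is_extension (shift C 1 X1) (shift C 1 ?P) (shift C 1 Z)"
    using is_extension_rotate_left[OF is_extensionI[OF D]] by simp
  ultimately show thesis using that is_extension_shiftD by blast
qed

text \<open>The pieces of \<open>M\<close> come in the order P1, Q1, P2, Q2, and the orthogonality
  allows the middle two to be exchanged. \<open>K\<close> is the part with pieces P1, Q1,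
  P2.\<close>

lemma extension_of_extensions:
  assumes "is_extension M1 M M2" "is_extension P1 M1 Q1" "is_extension P2 M2 Q2"
    and "orth P2 (shift C 1 Q1)"
  obtains P Q where "is_extension P M Q" "is_extension P1 P P2" "is_extension Q1 Q Q2"
proof -
  obtain K where K: "is_extension M1 K P2" "is_extension K M Q2" using ex_middle_left[OF assms(1,3)] .
  obtain P where P: "is_extension P1 P P2" "is_extension P K Q1" using ex_middle_swap[OF K(1) assms(2,4)] .
  obtain Q where "is_extension P M Q" "is_extension Q1 Q Q2" using ex_middle_right[OF K(2) P(2)] .
  then show thesis using that P(1) by blast
qed

lemma extension_closure_mono: "S \<subseteq> T \<Longrightarrow> X \<in> extension_closure C S \<Longrightarrow> X \<in> extension_closure C T"
proof (rotate_tac, induction rule: extension_closure.induct)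
  case (extension X Z Y f g h)
  then show ?case by (meson extension_closure.extension)
qed (auto intro: extension_closure.intros)

lemma extension_closure_extension:
  "\<lbrakk>X \<in> extension_closure C S; Z \<in> extension_closure C S; is_extension X Y Z\<rbrakk> \<Longrightarrow> Y \<in> extension_closure C S"
  by (auto simp: is_extension_def intro: extension_closure.extension)

lemma extension_closure_induct [consumes 1, case_names base zero extension]:
  assumes "X \<in> extension_closure C S"
    and "\<And>X. X \<in> S \<Longrightarrow> P X"
    and "\<And>X. zero_object C UNIV X \<Longrightarrow> P X"
    and "\<And>X Y Z. \<lbrakk>X \<in> extension_closure C S; Z \<in> extension_closure C S; P X; P Z; is_extension X Y Z\<rbrakk> \<Longrightarrow> P Y"
  shows "P X"
  using assms(1)
  by (induction rule: extension_closure.induct) (use assms(2-) is_extensionI in blast)+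

lemma orth_extension_closure_left:
  assumes "X \<in> extension_closure C S" "\<And>X. X \<in> S \<Longrightarrow> orth X W"
  shows "orth X W"
  using assms(1)
  by (induction rule: extension_closure_induct) (use assms(2) orth_zero_left orth_extension_left in blast)+

lemma orth_extension_closure_right:
  assumes "X \<in> extension_closure C S" "\<And>X. X \<in> S \<Longrightarrow> orth W X"
  shows "orth W X"
  using assms(1)
  by (induction rule: extension_closure_induct) (use assms(2) orth_zero_right orth_extension_right in blast)+

end

section \<open>Weight structures and t-structures\<close>

context weight_structure
begin

lemma mem_w_le: "X \<in> w_le C Wle n \<longleftrightarrow> shift C (- n) X \<in> Wle"
proof
  assume "shift C (- n) X \<in> Wle"
  then have "shift C n (shift C (- n) X) \<in> w_le C Wle n" unfolding w_le_def by (rule imageI)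
  then show "X \<in> w_le C Wle n" by simp
qed (auto simp: w_le_def)

lemma mem_w_ge: "X \<in> w_ge C Wge n \<longleftrightarrow> shift C (- n) X \<in> Wge"
proof
  assume "shift C (- n) X \<in> Wge"
  then have "shift C n (shift C (- n) X) \<in> w_ge C Wge n" unfolding w_ge_def by (rule imageI)
  then show "X \<in> w_ge C Wge n" by simp
qed (auto simp: w_ge_def)

lemma shift_mem_w_le: "shift C m X \<in> w_le C Wle n \<longleftrightarrow> X \<in> w_le C Wle (n - m)"
  by (simp add: mem_w_le)

lemma shift_mem_w_ge: "shift C m X \<in> w_ge C Wge n \<longleftrightarrow> X \<in> w_ge C Wge (n - m)"
  by (simp add: mem_w_ge)

lemma w_le_mono_le:
  assumes "m \<le> n" "X \<in> w_le C Wle m"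
  shows "X \<in> w_le C Wle n"
  using assms
proof (induction n rule: int_ge_induct)
  case (step i)
  then have "shift C (- i) X \<in> w_le C Wle 0" by (simp add: shift_mem_w_le)
  then have "shift C (- i) X \<in> w_le C Wle 1" using w_le_mono by blast
  then show ?case by (simp add: shift_mem_w_le add.commute)
qed

lemma w_ge_mono_ge:
  assumes "n \<le> m" "X \<in> w_ge C Wge m"
  shows "X \<in> w_ge C Wge n"
  using assms
proof (induction m rule: int_ge_induct)
  case (step i)
  then have "shift C (- i) X \<in> w_ge C Wge 1" by (simp add: shift_mem_w_ge add.commute)
  then have "shift C (- i) X \<in> w_ge C Wge 0" using w_ge_mono by blast
  then show ?case using step by (simp add: shift_mem_w_ge)
qed

lemma orth_w:
  assumes "X \<in> w_le C Wle m" "Y \<in> w_ge C Wge n" "m < n"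
  shows "orth X Y"
proof -
  have "shift C (- m) X \<in> w_le C Wle 0" using assms by (simp add: shift_mem_w_le)
  moreover have "Y \<in> w_ge C Wge (m + 1)" using w_ge_mono_ge[of "m + 1" n Y] assms by simp
  then have "shift C (- m) Y \<in> w_ge C Wge 1" by (simp add: shift_mem_w_ge add.commute)
  ultimately have "orth (shift C (- m) X) (shift C (- m) Y)" using w_orthogonal orth_iff by blast
  then show ?thesis using orth_shift by blast
qed

lemma w_decomposition_at:
  obtains X Y where "X \<in> w_le C Wle n" "Y \<in> w_ge C Wge (n + 1)" "is_extension X M Y"
proof -
  obtain X Y f g h where *: "X \<in> w_le C Wle 0" "Y \<in> w_ge C Wge 1" "dist_tri C X (shift C (- n) M) Y f g h"
    using w_decomposition by blast
  show thesis
  proof (rule that[of "shift C n X" "shift C n Y"])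
    show "is_extension (shift C n X) M (shift C n Y)"
      using is_extension_shift[OF is_extensionI[OF *(3)], of n] by simp
  qed (use * in \<open>simp_all add: shift_mem_w_le shift_mem_w_ge\<close>)
qed

text \<open>If nothing of lower weight maps to M, the first map of a weight decomposition is zero,
  so the triangle splits and M is a direct factor of the part of higher weight. Stability under
  extensions is read off from this description.\<close>

lemma mem_w_ge_iff_orth: "M \<in> w_ge C Wge n \<longleftrightarrow> (\<forall>X \<in> w_le C Wle (n - 1). orth X M)"
proof
  assume o: "\<forall>X \<in> w_le C Wle (n - 1). orth X M"
  let ?M = "shift C (- n) M"
  obtain X Y where *: "X \<in> w_le C Wle (- 1)" "Y \<in> w_ge C Wge 0" "is_extension X ?M Y"
    using w_decomposition_at[of "- 1" ?M] by auto
  obtain f g h where t: "dist_tri C X ?M Y f g h" using *(3) is_extensionE by blast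
  have "orth (shift C n X) M" using o *(1) by (simp add: shift_mem_w_le)
  then have "orth X ?M" using orth_shift[of "n" X ?M] by simp
  then have "f = zero_mor C X ?M" using orthD tri_mor[OF t] by blast
  then have "dist_tri C ?M Y (shift C 1 X) g h (zero_mor C (shift C 1 X) (shift C 1 ?M))"
    using tri_rotate_left[OF t] by (simp add: shift_mor_zero_mor uminus_zero_mor)
  then have "direct_factor C ?M Y" using split_triangle direct_factors_biproduct by blast
  then have "?M \<in> Wge" using Wge_direct_factor *(2) mem_w_ge[of Y 0] by simp
  then show "M \<in> w_ge C Wge n" by (simp add: mem_w_ge)
qed (auto intro: orth_w)

lemma mem_w_le_iff_orth: "M \<in> w_le C Wle n \<longleftrightarrow> (\<forall>Y \<in> w_ge C Wge (n + 1). orth M Y)"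
proof
  assume o: "\<forall>Y \<in> w_ge C Wge (n + 1). orth M Y"
  let ?M = "shift C (- n) M"
  obtain X Y where *: "X \<in> w_le C Wle 0" "Y \<in> w_ge C Wge 1" "is_extension X ?M Y"
    using w_decomposition_at[of 0 ?M] by auto
  obtain f g h where t: "dist_tri C X ?M Y f g h" using *(3) is_extensionE by blast
  have "orth M (shift C n Y)" using o *(2) by (simp add: shift_mem_w_ge)
  then have "orth ?M Y" using orth_shift[of "n" ?M Y] by simp
  then have "g = zero_mor C ?M Y" using orthD tri_mor[OF t] by blast
  then have "dist_tri C (shift C (- 1) Y) X ?M
      (\<ominus>\<^bsub>Hom C (shift C (- 1) Y) X\<^esub> shift_mor C (- 1) h) f (zero_mor C ?M (shift C 1 (shift C (- 1) Y)))"
    using tri_rotate_right[OF t] by simp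
  then have "direct_factor C ?M X" using split_triangle direct_factors_biproduct by blast
  then have "?M \<in> Wle" using Wle_direct_factor *(1) mem_w_le[of X 0] by simp
  then show "M \<in> w_le C Wle n" by (simp add: mem_w_le)
qed (auto intro: orth_w)

lemma w_ge_extension:
  "\<lbrakk>is_extension X Y Z; X \<in> w_ge C Wge n; Z \<in> w_ge C Wge n\<rbrakk> \<Longrightarrow> Y \<in> w_ge C Wge n"
  using orth_extension_right unfolding mem_w_ge_iff_orth by blast

lemma w_le_extension:
  "\<lbrakk>is_extension X Y Z; X \<in> w_le C Wle n; Z \<in> w_le C Wle n\<rbrakk> \<Longrightarrow> Y \<in> w_le C Wle n"
  using orth_extension_left unfolding mem_w_le_iff_orth by blast

lemma zero_mem_w_ge: "zero_object C UNIV Z \<Longrightarrow> Z \<in> w_ge C Wge n"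
  using orth_zero_right unfolding mem_w_ge_iff_orth by blast

lemma zero_mem_w_le: "zero_object C UNIV Z \<Longrightarrow> Z \<in> w_le C Wle n"
  using orth_zero_left unfolding mem_w_le_iff_orth by blast

lemma extension_closure_w_ge:
  "X \<in> extension_closure C S \<Longrightarrow> S \<subseteq> w_ge C Wge n \<Longrightarrow> X \<in> w_ge C Wge n"
  by (induction rule: extension_closure_induct) (auto intro: zero_mem_w_ge w_ge_extension)

lemma extension_closure_w_le:
  "X \<in> extension_closure C S \<Longrightarrow> S \<subseteq> w_le C Wle n \<Longrightarrow> X \<in> w_le C Wle n"
  by (induction rule: extension_closure_induct) (auto intro: zero_mem_w_le w_le_extension)

end

context t_structure
begin

lemma mem_t_le: "X \<in> t_le C Tle n \<longleftrightarrow> shift C n X \<in> Tle"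
proof
  assume "shift C n X \<in> Tle"
  then have "shift C (- n) (shift C n X) \<in> t_le C Tle n" unfolding t_le_def by (rule imageI)
  then show "X \<in> t_le C Tle n" by simp
qed (auto simp: t_le_def)

lemma mem_t_ge: "X \<in> t_ge C Tge n \<longleftrightarrow> shift C n X \<in> Tge"
proof
  assume "shift C n X \<in> Tge"
  then have "shift C (- n) (shift C n X) \<in> t_ge C Tge n" unfolding t_ge_def by (rule imageI)
  then show "X \<in> t_ge C Tge n" by simp
qed (auto simp: t_ge_def)

lemma shift_mem_t_le: "shift C m X \<in> t_le C Tle n \<longleftrightarrow> X \<in> t_le C Tle (n + m)"
  by (simp add: mem_t_le)

lemma shift_mem_t_ge: "shift C m X \<in> t_ge C Tge n \<longleftrightarrow> X \<in> t_ge C Tge (n + m)"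
  by (simp add: mem_t_ge)

lemma t_le_mono_le:
  assumes "m \<le> n" "X \<in> t_le C Tle m"
  shows "X \<in> t_le C Tle n"
  using assms
proof (induction n rule: int_ge_induct)
  case (step i)
  then have "shift C i X \<in> t_le C Tle 0" by (simp add: shift_mem_t_le)
  then have "shift C i X \<in> t_le C Tle 1" using t_le_mono by blast
  then show ?case by (simp add: shift_mem_t_le add.commute)
qed

lemma t_ge_mono_ge:
  assumes "n \<le> m" "X \<in> t_ge C Tge m"
  shows "X \<in> t_ge C Tge n"
  using assms
proof (induction m rule: int_ge_induct)
  case (step i)
  then have "shift C i X \<in> t_ge C Tge 1" by (simp add: shift_mem_t_ge add.commute)
  then have "shift C i X \<in> t_ge C Tge 0" using t_ge_mono by blast
  then show ?case using step by (simp add: shift_mem_t_ge)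
qed

lemma orth_t:
  assumes "X \<in> t_le C Tle m" "Y \<in> t_ge C Tge n" "m < n"
  shows "orth X Y"
proof -
  have "shift C m X \<in> t_le C Tle 0" using assms by (simp add: shift_mem_t_le)
  moreover have "Y \<in> t_ge C Tge (m + 1)" using t_ge_mono_ge[of "m + 1" n Y] assms by simp
  then have "shift C m Y \<in> t_ge C Tge 1" by (simp add: shift_mem_t_ge add.commute)
  ultimately have "orth (shift C m X) (shift C m Y)" using t_orthogonal orth_iff by blast
  then show ?thesis using orth_shift by blast
qed

lemma t_decomposition_at:
  obtains X Y where "X \<in> t_le C Tle n" "Y \<in> t_ge C Tge (n + 1)" "is_extension X M Y"
proof -
  obtain X Y f g h where *: "X \<in> t_le C Tle 0" "Y \<in> t_ge C Tge 1" "dist_tri C X (shift C n M) Y f g h"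
    using t_decomposition by blast
  show thesis
  proof (rule that[of "shift C (- n) X" "shift C (- n) Y"])
    show "is_extension (shift C (- n) X) M (shift C (- n) Y)"
      using is_extension_shift[OF is_extensionI[OF *(3)], of "- n"] by simp
  qed (use * in \<open>simp_all add: shift_mem_t_le shift_mem_t_ge\<close>)
qed

text \<open>Here closure under isomorphism has to suffice: the identity lifts to a section of
  \<open>f\<close>, and the uniqueness in \<open>tri_mono\<close> makes this section a two-sided
  inverse.\<close>

lemma mem_t_le_iff_orth: "M \<in> t_le C Tle n \<longleftrightarrow> (\<forall>Y \<in> t_ge C Tge (n + 1). orth M Y)"
proof
  assume o: "\<forall>Y \<in> t_ge C Tge (n + 1). orth M Y"
  let ?M = "shift C n M"
  obtain X Y f g h where *: "X \<in> t_le C Tle 0" "Y \<in> t_ge C Tge 1" and t: "dist_tri C X ?M Y f g h"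
    using t_decomposition by blast
  have m: "f \<in> mor C X ?M" "g \<in> mor C ?M Y" using tri_mor[OF t] by auto
  have "orth M (shift C (- n) Y)" using o *(2) by (simp add: shift_mem_t_ge add.commute)
  then have o': "orth ?M Y" using orth_shift[of "- n" ?M Y] by simp
  obtain s where s: "s \<in> mor C ?M X" "f \<bullet> s = ident C ?M"
    by (rule tri_lift_orth[OF t ident_mor o'])
  have "f \<bullet> (s \<bullet> f) = f \<bullet> ident C X"
    using cmp_assoc[OF m(1) s(1) m(1)] s ident_left[OF m(1)] ident_right[OF m(1)] by simp
  moreover have "orth X (shift C (- 1) Y)"
    by (rule orth_t[OF *(1), of _ 2]) (use * in \<open>simp_all add: shift_mem_t_ge\<close>)
  ultimately have "s \<bullet> f = ident C X"
    using tri_mono[OF t _ cmp_mor[OF m(1) s(1)] ident_mor] by blast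
  then have "isomorphic C X ?M" unfolding isomorphic_def is_iso_def using m s by blast
  then have "?M \<in> Tle" using Tle_iso *(1) mem_t_le[of X 0] by simp
  then show "M \<in> t_le C Tle n" by (simp add: mem_t_le)
qed (auto intro: orth_t)

lemma mem_t_ge_iff_orth: "M \<in> t_ge C Tge n \<longleftrightarrow> (\<forall>X \<in> t_le C Tle (n - 1). orth X M)"
proof
  assume o: "\<forall>X \<in> t_le C Tle (n - 1). orth X M"
  let ?M = "shift C n M"
  obtain X Y where *: "X \<in> t_le C Tle (- 1)" "Y \<in> t_ge C Tge 0" and "is_extension X ?M Y"
    using t_decomposition_at[of "- 1" ?M] by auto
  then obtain f g h where t: "dist_tri C X ?M Y f g h" using is_extensionE by blast
  have m: "f \<in> mor C X ?M" "g \<in> mor C ?M Y" using tri_mor[OF t] by auto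
  have "orth (shift C (- n) X) M" using o *(1) by (simp add: shift_mem_t_le)
  then have o': "orth X ?M" using orth_shift[of "- n" X ?M] by simp
  obtain s where s: "s \<in> mor C Y ?M" "s \<bullet> g = ident C ?M"
    by (rule tri_extend_orth[OF t ident_mor o'])
  have "(g \<bullet> s) \<bullet> g = ident C Y \<bullet> g"
    using cmp_assoc[OF m(2) s(1) m(2)] s ident_left[OF m(2)] ident_right[OF m(2)] by simp
  moreover have "orth (shift C 1 X) Y"
    by (rule orth_t[OF _ *(2), of _ "- 2"]) (use * in \<open>simp_all add: shift_mem_t_le\<close>)
  ultimately have "g \<bullet> s = ident C Y"
    using tri_epi[OF t _ cmp_mor[OF s(1) m(2)] ident_mor] by blast
  then have "isomorphic C Y ?M" unfolding isomorphic_def is_iso_def using m s by blast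
  then have "?M \<in> Tge" using Tge_iso *(2) mem_t_ge[of Y 0] by simp
  then show "M \<in> t_ge C Tge n" by (simp add: mem_t_ge)
qed (auto intro: orth_t)

lemma t_ge_extension:
  "\<lbrakk>is_extension X Y Z; X \<in> t_ge C Tge n; Z \<in> t_ge C Tge n\<rbrakk> \<Longrightarrow> Y \<in> t_ge C Tge n"
  using orth_extension_right unfolding mem_t_ge_iff_orth by blast

lemma t_le_extension:
  "\<lbrakk>is_extension X Y Z; X \<in> t_le C Tle n; Z \<in> t_le C Tle n\<rbrakk> \<Longrightarrow> Y \<in> t_le C Tle n"
  using orth_extension_left unfolding mem_t_le_iff_orth by blast

lemma zero_mem_t_ge: "zero_object C UNIV Z \<Longrightarrow> Z \<in> t_ge C Tge n"
  using orth_zero_right unfolding mem_t_ge_iff_orth by blast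

lemma zero_mem_t_le: "zero_object C UNIV Z \<Longrightarrow> Z \<in> t_le C Tle n"
  using orth_zero_left unfolding mem_t_le_iff_orth by blast

lemma mem_heart_iff: "X \<in> heart Tle Tge \<longleftrightarrow> X \<in> t_le C Tle 0 \<and> X \<in> t_ge C Tge 0"
  by (simp add: heart_def mem_t_le mem_t_ge)

end

section \<open>Morphisms vanishing on cohomology\<close>

context t_structure
begin

lemma trunc_triangle_ex:
  "\<exists>X Y f g h. trunc_triangle C Tle Tge n M = (X, Y, f, g, h) \<and>
    X \<in> t_le C Tle n \<and> Y \<in> t_ge C Tge (n + 1) \<and> dist_tri C X M Y f g h"
proof -
  let ?P = "\<lambda>(X, Y, f, g, h). X \<in> t_le C Tle n \<and> Y \<in> t_ge C Tge (n + 1) \<and> dist_tri C X M Y f g h"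
  obtain X Y where X: "X \<in> t_le C Tle n" "Y \<in> t_ge C Tge (n + 1)" "is_extension X M Y"
    by (rule t_decomposition_at)
  obtain f g h where "dist_tri C X M Y f g h" using X(3) by (rule is_extensionE)
  then have "?P (X, Y, f, g, h)" using X by simp
  then have "?P (trunc_triangle C Tle Tge n M)" unfolding trunc_triangle_def by (rule someI)
  then show ?thesis by (cases "trunc_triangle C Tle Tge n M") auto
qed

lemma trunc_le_triangle:
  obtains Y g h where "Y \<in> t_ge C Tge (n + 1)"
    "dist_tri C (trunc_le C Tle Tge n M) M Y (trunc_le_map C Tle Tge n M) g h"
  using trunc_triangle_ex[of n M] unfolding trunc_le_def trunc_le_map_def by auto

lemma trunc_ge_triangle:
  obtains X f h where "X \<in> t_le C Tle (n - 1)"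
    "dist_tri C X M (trunc_ge C Tle Tge n M) f (trunc_ge_map C Tle Tge n M) h"
  using trunc_triangle_ex[of "n - 1" M] unfolding trunc_ge_def trunc_ge_map_def by auto

lemma trunc_le_mem: "trunc_le C Tle Tge n M \<in> t_le C Tle n"
  using trunc_triangle_ex[of n M] unfolding trunc_le_def by auto

lemma trunc_ge_mem: "trunc_ge C Tle Tge n M \<in> t_ge C Tge n"
  using trunc_triangle_ex[of "n - 1" M] unfolding trunc_ge_def by auto

lemma trunc_le_map_mor: "trunc_le_map C Tle Tge n M \<in> mor C (trunc_le C Tle Tge n M) M"
  by (rule trunc_le_triangle[of n M]) (auto dest: tri_mor)

lemma trunc_ge_map_mor: "trunc_ge_map C Tle Tge n M \<in> mor C M (trunc_ge C Tle Tge n M)"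
  by (rule trunc_ge_triangle[of n M]) (auto dest: tri_mor)

lemma trunc_le_lift:
  assumes "X \<in> t_le C Tle n" "u \<in> mor C X M"
  obtains u' where "u' \<in> mor C X (trunc_le C Tle Tge n M)" "trunc_le_map C Tle Tge n M \<bullet> u' = u"
proof -
  obtain Y g h where Y: "Y \<in> t_ge C Tge (n + 1)"
    and t: "dist_tri C (trunc_le C Tle Tge n M) M Y (trunc_le_map C Tle Tge n M) g h"
    by (rule trunc_le_triangle)
  have "orth X Y" by (rule orth_t[OF assms(1) Y]) simp
  from tri_lift_orth[OF t assms(2) this] that show thesis by blast
qed

lemma trunc_le_map_cancel:
  assumes "X \<in> t_le C Tle n" "u \<in> mor C X (trunc_le C Tle Tge n M)" "u' \<in> mor C X (trunc_le C Tle Tge n M)"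
    "trunc_le_map C Tle Tge n M \<bullet> u = trunc_le_map C Tle Tge n M \<bullet> u'"
  shows "u = u'"
proof -
  obtain Y g h where Y: "Y \<in> t_ge C Tge (n + 1)"
    and t: "dist_tri C (trunc_le C Tle Tge n M) M Y (trunc_le_map C Tle Tge n M) g h"
    by (rule trunc_le_triangle)
  have "orth X (shift C (- 1) Y)"
    by (rule orth_t[OF assms(1), of _ "n + 2"]) (use Y in \<open>simp_all add: shift_mem_t_ge add.commute\<close>)
  from tri_mono[OF t this assms(2-4)] show ?thesis .
qed

lemma trunc_ge_extend:
  assumes "Y \<in> t_ge C Tge n" "v \<in> mor C M Y"
  obtains v' where "v' \<in> mor C (trunc_ge C Tle Tge n M) Y" "v' \<bullet> trunc_ge_map C Tle Tge n M = v"
proof -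
  obtain X f h where X: "X \<in> t_le C Tle (n - 1)"
    and t: "dist_tri C X M (trunc_ge C Tle Tge n M) f (trunc_ge_map C Tle Tge n M) h"
    by (rule trunc_ge_triangle)
  have "orth X Y" by (rule orth_t[OF X assms(1)]) simp
  from tri_extend_orth[OF t assms(2) this] that show thesis by blast
qed

lemma trunc_ge_map_cancel:
  assumes "Y \<in> t_ge C Tge n" "v \<in> mor C (trunc_ge C Tle Tge n M) Y" "v' \<in> mor C (trunc_ge C Tle Tge n M) Y"
    "v \<bullet> trunc_ge_map C Tle Tge n M = v' \<bullet> trunc_ge_map C Tle Tge n M"
  shows "v = v'"
proof -
  obtain X f h where X: "X \<in> t_le C Tle (n - 1)"
    and t: "dist_tri C X M (trunc_ge C Tle Tge n M) f (trunc_ge_map C Tle Tge n M) h"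
    by (rule trunc_ge_triangle)
  have "orth (shift C 1 X) Y"
    by (rule orth_t[OF _ assms(1), of _ "n - 2"]) (use X in \<open>simp_all add: shift_mem_t_le\<close>)
  from tri_epi[OF t this assms(2-4)] show ?thesis .
qed

text \<open>\<open>trunc_le_lift\<close> gives existence and \<open>trunc_le_map_cancel\<close>
  uniqueness for the \<open>THE\<close> in the definition.\<close>

lemma trunc_le_mor:
  assumes "\<alpha> \<in> mor C M N"
  shows "trunc_le_mor C Tle Tge n M N \<alpha> \<in> mor C (trunc_le C Tle Tge n M) (trunc_le C Tle Tge n N)"
    and "trunc_le_map C Tle Tge n N \<bullet> trunc_le_mor C Tle Tge n M N \<alpha> = \<alpha> \<bullet> trunc_le_map C Tle Tge n M"
proof -
  let ?P = "\<lambda>\<beta>. \<beta> \<in> mor C (trunc_le C Tle Tge n M) (trunc_le C Tle Tge n N) \<and>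
        trunc_le_map C Tle Tge n N \<bullet> \<beta> = \<alpha> \<bullet> trunc_le_map C Tle Tge n M"
  have "\<alpha> \<bullet> trunc_le_map C Tle Tge n M \<in> mor C (trunc_le C Tle Tge n M) N"
    using cmp_mor[OF trunc_le_map_mor assms] .
  from trunc_le_lift[OF trunc_le_mem this] obtain \<beta> where "?P \<beta>" by blast
  moreover have "\<beta>' = \<beta>" if "?P \<beta>'" for \<beta>'
    using trunc_le_map_cancel[OF trunc_le_mem[of n M], where u = \<beta>' and u' = \<beta> and M = N] that \<open>?P \<beta>\<close> by simp
  ultimately have "?P (trunc_le_mor C Tle Tge n M N \<alpha>)"
    unfolding trunc_le_mor_def by (rule theI)
  then show "trunc_le_mor C Tle Tge n M N \<alpha> \<in> mor C (trunc_le C Tle Tge n M) (trunc_le C Tle Tge n N)"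
    and "trunc_le_map C Tle Tge n N \<bullet> trunc_le_mor C Tle Tge n M N \<alpha> = \<alpha> \<bullet> trunc_le_map C Tle Tge n M"
    by auto
qed

lemma trunc_ge_mor:
  assumes "\<alpha> \<in> mor C M N"
  shows "trunc_ge_mor C Tle Tge n M N \<alpha> \<in> mor C (trunc_ge C Tle Tge n M) (trunc_ge C Tle Tge n N)"
    and "trunc_ge_mor C Tle Tge n M N \<alpha> \<bullet> trunc_ge_map C Tle Tge n M = trunc_ge_map C Tle Tge n N \<bullet> \<alpha>"
proof -
  let ?P = "\<lambda>\<beta>. \<beta> \<in> mor C (trunc_ge C Tle Tge n M) (trunc_ge C Tle Tge n N) \<and>
        \<beta> \<bullet> trunc_ge_map C Tle Tge n M = trunc_ge_map C Tle Tge n N \<bullet> \<alpha>"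
  have "trunc_ge_map C Tle Tge n N \<bullet> \<alpha> \<in> mor C M (trunc_ge C Tle Tge n N)"
    using cmp_mor[OF assms trunc_ge_map_mor] .
  from trunc_ge_extend[OF trunc_ge_mem this] obtain \<beta> where "?P \<beta>" by blast
  moreover have "\<beta>' = \<beta>" if "?P \<beta>'" for \<beta>'
    using trunc_ge_map_cancel[OF trunc_ge_mem[of n N], where v = \<beta>' and v' = \<beta> and M = M] that \<open>?P \<beta>\<close> by simp
  ultimately have "?P (trunc_ge_mor C Tle Tge n M N \<alpha>)"
    unfolding trunc_ge_mor_def by (rule theI)
  then show "trunc_ge_mor C Tle Tge n M N \<alpha> \<in> mor C (trunc_ge C Tle Tge n M) (trunc_ge C Tle Tge n N)"
    and "trunc_ge_mor C Tle Tge n M N \<alpha> \<bullet> trunc_ge_map C Tle Tge n M = trunc_ge_map C Tle Tge n N \<bullet> \<alpha>"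
    by auto
qed

text \<open>A description of \<open>H^m(\<alpha>) = 0\<close> that does not involve any choice of truncations.\<close>
definition cohom_null :: "int \<Rightarrow> 'o \<Rightarrow> 'o \<Rightarrow> 'm \<Rightarrow> bool" where
  "cohom_null m M N \<alpha> \<longleftrightarrow> (\<forall>X \<in> t_le C Tle m. \<forall>Y \<in> t_ge C Tge m. \<forall>u \<in> mor C X M. \<forall>v \<in> mor C N Y.
     v \<bullet> (\<alpha> \<bullet> u) = zero_mor C X Y)"

lemma cohom_nullD:
  "\<lbrakk>cohom_null m M N \<alpha>; X \<in> t_le C Tle m; Y \<in> t_ge C Tge m; u \<in> mor C X M; v \<in> mor C N Y\<rbrakk> \<Longrightarrow>
    v \<bullet> (\<alpha> \<bullet> u) = zero_mor C X Y"
  by (simp add: cohom_null_def)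

text \<open>The map from N to its part in degrees \<ge> m is an admissible test map, so it kills
  \<alpha> u. In this form the vanishing lowers the degree of a source by one, which drives the
  nilpotence argument.\<close>

lemma cohom_null_factor:
  assumes a: "\<alpha> \<in> mor C M N" and n: "cohom_null m M N \<alpha>"
    and X: "X \<in> t_le C Tle m" and u: "u \<in> mor C X M"
  obtains L w \<delta> where "L \<in> t_le C Tle (m - 1)" "w \<in> mor C L N" "\<delta> \<in> mor C X L" "w \<bullet> \<delta> = \<alpha> \<bullet> u"
proof -
  obtain L Y where L: "L \<in> t_le C Tle (m - 1)" "Y \<in> t_ge C Tge m" "is_extension L N Y"
    using t_decomposition_at[of "m - 1" N] by auto
  obtain f g h where t: "dist_tri C L N Y f g h" using L(3) is_extensionE by blast
  have f: "f \<in> mor C L N" "g \<in> mor C N Y" using tri_mor[OF t] by auto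
  from tri_lift[OF t cmp_mor[OF u a] cohom_nullD[OF n X L(2) u f(2)]] that L(1) f(1)
  show thesis by blast
qed

text \<open>Cancelling the truncation map \<open>?q\<close> turns the claim into one about
  \<open>?q' \<bullet> ?b\<close>. Each test map \<open>u\<close> factors through \<open>?p\<close>,
  and each \<open>v\<close>, restricted to \<open>Q\<close>, factors through
  \<open>?q'\<close>.\<close>

lemma cohom_null_0_iff:
  assumes a: "\<alpha> \<in> mor C M N"
  defines "P \<equiv> trunc_le C Tle Tge 0 M" and "Q \<equiv> trunc_le C Tle Tge 0 N"
  shows "trunc_ge_mor C Tle Tge 0 P Q (trunc_le_mor C Tle Tge 0 M N \<alpha>) =
      zero_mor C (trunc_ge C Tle Tge 0 P) (trunc_ge C Tle Tge 0 Q) \<longleftrightarrow> cohom_null 0 M N \<alpha>"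
proof -
  let ?b = "trunc_le_mor C Tle Tge 0 M N \<alpha>"
  let ?p = "trunc_le_map C Tle Tge 0 M" and ?p' = "trunc_le_map C Tle Tge 0 N"
  let ?q = "trunc_ge_map C Tle Tge 0 P" and ?q' = "trunc_ge_map C Tle Tge 0 Q"
  let ?H = "trunc_ge_mor C Tle Tge 0 P Q ?b" and ?E = "trunc_ge C Tle Tge 0 P" and ?F = "trunc_ge C Tle Tge 0 Q"
  have b: "?b \<in> mor C P Q" "?p' \<bullet> ?b = \<alpha> \<bullet> ?p"
    using trunc_le_mor[OF a] unfolding P_def Q_def by auto
  have H: "?H \<in> mor C ?E ?F" "?H \<bullet> ?q = ?q' \<bullet> ?b" using trunc_ge_mor[OF b(1)] by auto
  have p: "?p \<in> mor C P M" "?p' \<in> mor C Q N" unfolding P_def Q_def by (rule trunc_le_map_mor)+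
  have q: "?q \<in> mor C P ?E" "?q' \<in> mor C Q ?F" by (rule trunc_ge_map_mor)+
  have "?H = zero_mor C ?E ?F \<longleftrightarrow> ?H \<bullet> ?q = zero_mor C ?E ?F \<bullet> ?q"
    using trunc_ge_map_cancel[OF trunc_ge_mem H(1)] by auto
  also have "\<dots> \<longleftrightarrow> ?q' \<bullet> ?b = zero_mor C P ?F" using H(2) cmp_zero_left[OF q(1)] by simp
  also have "\<dots> \<longleftrightarrow> cohom_null 0 M N \<alpha>"
  proof
    assume z: "?q' \<bullet> ?b = zero_mor C P ?F"
    show "cohom_null 0 M N \<alpha>" unfolding cohom_null_def
    proof (intro ballI)
      fix X Y u v
      assume X: "X \<in> t_le C Tle 0" and Y: "Y \<in> t_ge C Tge 0" and u: "u \<in> mor C X M" and v: "v \<in> mor C N Y"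
      obtain u' where u': "u' \<in> mor C X P" "?p \<bullet> u' = u" using trunc_le_lift[OF X u] unfolding P_def .
      obtain v' where v': "v' \<in> mor C ?F Y" "v' \<bullet> ?q' = v \<bullet> ?p'"
        using trunc_ge_extend[OF Y cmp_mor[OF p(2) v]] .
      have "v \<bullet> (\<alpha> \<bullet> u) = v \<bullet> ((?p' \<bullet> ?b) \<bullet> u')"
        using u' b(2) cmp_assoc[OF u'(1) p(1) a] by simp
      also have "\<dots> = ((v \<bullet> ?p') \<bullet> ?b) \<bullet> u'"
        using cmp_assoc[OF u'(1) cmp_mor[OF b(1) p(2)] v] cmp_assoc[OF b(1) p(2) v] by simp
      also have "\<dots> = (v' \<bullet> (?q' \<bullet> ?b)) \<bullet> u'" using v' cmp_assoc[OF b(1) q(2) v'(1)] by simp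
      also have "\<dots> = zero_mor C X Y" using z cmp_zero_right[OF v'(1)] cmp_zero_left[OF u'(1)] by simp
      finally show "v \<bullet> (\<alpha> \<bullet> u) = zero_mor C X Y" .
    qed
  next
    assume n: "cohom_null 0 M N \<alpha>"
    have P: "P \<in> t_le C Tle 0" unfolding P_def by (rule trunc_le_mem)
    \<comment> \<open>With \<open>?p\<close> as test map, \<alpha> \<open>?p\<close> factors through
      degrees \<le> -1. By uniqueness of lifts to \<open>Q\<close> the same holds for
      \<open>?b\<close>, and nothing in those degrees maps to \<open>?F\<close>.\<close>
    obtain L w \<delta> where L: "L \<in> t_le C Tle (- 1)" "w \<in> mor C L N" "\<delta> \<in> mor C P L" "w \<bullet> \<delta> = \<alpha> \<bullet> ?p"
      using cohom_null_factor[OF a n P p(1)] by auto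
    have "L \<in> t_le C Tle 0" by (rule t_le_mono_le[OF _ L(1)]) simp
    then obtain w' where w': "w' \<in> mor C L Q" "?p' \<bullet> w' = w"
      using trunc_le_lift[OF _ L(2)] unfolding Q_def by blast
    have "?p' \<bullet> (w' \<bullet> \<delta>) = ?p' \<bullet> ?b" using cmp_assoc[OF L(3) w'(1) p(2)] w' L b by simp
    then have e: "w' \<bullet> \<delta> = ?b"
      using trunc_le_map_cancel[OF P] cmp_mor[OF L(3) w'(1)] b(1) unfolding Q_def by blast
    have "orth L ?F" by (rule orth_t[OF L(1) trunc_ge_mem]) simp
    then have "?q' \<bullet> w' = zero_mor C L ?F" using orthD cmp_mor[OF w'(1) q(2)] by blast
    then show "?q' \<bullet> ?b = zero_mor C P ?F"
      using e cmp_assoc[OF L(3) w'(1) q(2)] cmp_zero_left[OF L(3)] by simp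
  qed
  finally show ?thesis .
qed

text \<open>One implication is proved for all shifts and all morphisms; the converse is its instance
  at the shift by -m.\<close>

lemma cohom_null_shift_iff:
  assumes a: "\<alpha> \<in> mor C M N"
  shows "cohom_null n (shift C m M) (shift C m N) (shift_mor C m \<alpha>) \<longleftrightarrow> cohom_null (n + m) M N \<alpha>"
proof -
  have shifted: "cohom_null (n - m) (shift C m M) (shift C m N) (shift_mor C m \<alpha>)"
    if a: "\<alpha> \<in> mor C M N" and c: "cohom_null n M N \<alpha>" for n m M N \<alpha>
    unfolding cohom_null_def
  proof (intro ballI)
    fix X Y u v
    assume X: "X \<in> t_le C Tle (n - m)" and Y: "Y \<in> t_ge C Tge (n - m)"
      and u: "u \<in> mor C X (shift C m M)" and v: "v \<in> mor C (shift C m N) Y"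
    obtain u' where u': "u' \<in> mor C (shift C (- m) X) M" "shift_mor C m u' = u"
      using shift_mor_surj[of u m "shift C (- m) X" M] u by auto
    obtain v' where v': "v' \<in> mor C N (shift C (- m) Y)" "shift_mor C m v' = v"
      using shift_mor_surj[of v m N "shift C (- m) Y"] v by auto
    have "v' \<bullet> (\<alpha> \<bullet> u') = zero_mor C (shift C (- m) X) (shift C (- m) Y)"
      by (rule cohom_nullD[OF c _ _ u'(1) v'(1)]) (use X Y in \<open>simp_all add: shift_mem_t_le shift_mem_t_ge\<close>)
    then have "shift_mor C m (v' \<bullet> (\<alpha> \<bullet> u')) = zero_mor C X Y" by (simp add: shift_mor_zero_mor)
    then show "v \<bullet> (shift_mor C m \<alpha> \<bullet> u) = zero_mor C X Y"
      using shift_cmp[OF cmp_mor[OF u'(1) a] v'(1)] shift_cmp[OF u'(1) a] u'(2) v'(2) by simp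
  qed
  show ?thesis
    using shifted[OF a, of "n + m" m] shifted[OF shift_mor_mor[OF a, of m], of n "- m"]
      shift_mor_inverse[OF a, of "- m" m] by auto
qed

lemma cohom_mor_eq_zero_iff:
  assumes "\<alpha> \<in> mor C M N"
  shows "cohom_mor C Tle Tge m M N \<alpha> = zero_mor C (cohom C Tle Tge m M) (cohom C Tle Tge m N)
    \<longleftrightarrow> cohom_null m M N \<alpha>"
  unfolding cohom_mor_def cohom_def
  using cohom_null_0_iff[OF shift_mor_mor[OF assms]] cohom_null_shift_iff[OF assms, of 0 m] by simp

end

section \<open>Nilpotent endomorphisms and the geometric series\<close>

context linear_category
begin

text \<open>Powers of \<gamma> are encoded as iterated left composition applied to
  \<open>ident C M\<close>; the second claim lets an induction run over arbitrary \<open>f\<close>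
  instead of over powers.\<close>

lemma funpow_cmp_eq:
  assumes "\<gamma> \<in> mor C M M" "f \<in> mor C X M"
  shows "((\<lambda>f. \<gamma> \<bullet> f) ^^ k) f \<in> mor C X M"
    and "((\<lambda>f. \<gamma> \<bullet> f) ^^ k) (ident C M) \<bullet> f = ((\<lambda>f. \<gamma> \<bullet> f) ^^ k) f"
proof -
  have m: "((\<lambda>f. \<gamma> \<bullet> f) ^^ k) f \<in> mor C X M" if "f \<in> mor C X M" for k f X
    using that assms(1) by (induction k) (auto intro: cmp_mor)
  show "((\<lambda>f. \<gamma> \<bullet> f) ^^ k) f \<in> mor C X M" using m[OF assms(2)] .
  show "((\<lambda>f. \<gamma> \<bullet> f) ^^ k) (ident C M) \<bullet> f = ((\<lambda>f. \<gamma> \<bullet> f) ^^ k) f"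
    by (induction k) (simp_all add: ident_left[OF assms(2)] cmp_assoc[OF assms(2) m[OF ident_mor] assms(1)])
qed

lemma ident_minus_nilpotent_iso:
  assumes g: "\<gamma> \<in> mor C M M" and nil: "((\<lambda>f. \<gamma> \<bullet> f) ^^ k) (ident C M) = zero_mor C M M"
  shows "is_iso C M M (ident C M \<ominus>\<^bsub>Hom C M M\<^esub> \<gamma>)"
proof -
  let ?p = "\<lambda>k. ((\<lambda>f. \<gamma> \<bullet> f) ^^ k) (ident C M)" and ?d = "ident C M \<ominus>\<^bsub>Hom C M M\<^esub> \<gamma>"
  have p: "?p k \<in> mor C M M" for k using funpow_cmp_eq(1)[OF g ident_mor] .
  have d: "?d \<in> mor C M M" using g ident_mor by simp
  have pg: "?p k \<bullet> \<gamma> = \<gamma> \<bullet> ?p k" for k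
    using funpow_cmp_eq(2)[OF g g, of k] funpow_swap1[of "\<lambda>f. \<gamma> \<bullet> f" k "ident C M"] ident_right[OF g] by simp
  have tel: "(ident C M \<ominus>\<^bsub>Hom C M M\<^esub> x) \<oplus>\<^bsub>Hom C M M\<^esub> (x \<ominus>\<^bsub>Hom C M M\<^esub> y) = ident C M \<ominus>\<^bsub>Hom C M M\<^esub> y"
    if "x \<in> mor C M M" "y \<in> mor C M M" for x y
    using that ident_mor[of M] by (simp add: a_minus_def hom.a_assoc hom.r_neg1)
  \<comment> \<open>The witness is the sum of the powers below k; multiplied by 1 - \<gamma> it
    telescopes, by \<open>tel\<close>.\<close>
  have "\<exists>s \<in> mor C M M. ?d \<bullet> s = ident C M \<ominus>\<^bsub>Hom C M M\<^esub> ?p k \<and> s \<bullet> ?d = ident C M \<ominus>\<^bsub>Hom C M M\<^esub> ?p k" for k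
  proof (induction k)
    case 0
    have "ident C M \<ominus>\<^bsub>Hom C M M\<^esub> ?p 0 = zero_mor C M M" using minus_zero_iff[OF ident_mor ident_mor] by simp
    then show ?case using cmp_zero_left[OF d] cmp_zero_right[OF d] by (intro bexI[of _ "zero_mor C M M"]) simp_all
  next
    case (Suc k)
    then obtain s where s: "s \<in> mor C M M" "?d \<bullet> s = ident C M \<ominus>\<^bsub>Hom C M M\<^esub> ?p k"
      "s \<bullet> ?d = ident C M \<ominus>\<^bsub>Hom C M M\<^esub> ?p k" by blast
    let ?s = "s \<oplus>\<^bsub>Hom C M M\<^esub> ?p k"
    have "?d \<bullet> ?p k = ?p k \<ominus>\<^bsub>Hom C M M\<^esub> ?p (Suc k)"
      using cmp_minus_left[OF p ident_mor g, of k] ident_left[OF p] by simp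
    then have "?d \<bullet> ?s = ident C M \<ominus>\<^bsub>Hom C M M\<^esub> ?p (Suc k)"
      using cmp_add_right[OF s(1) p d, of k] s(2) tel[OF p p, of k "Suc k"] by simp
    moreover have "?p k \<bullet> ?d = ?p k \<ominus>\<^bsub>Hom C M M\<^esub> ?p (Suc k)"
      using cmp_minus_right[OF ident_mor g p, of k] ident_right[OF p] pg by simp
    then have "?s \<bullet> ?d = ident C M \<ominus>\<^bsub>Hom C M M\<^esub> ?p (Suc k)"
      using cmp_add_left[OF d s(1) p, of k] s(3) tel[OF p p, of k "Suc k"] by simp
    moreover have "?s \<in> mor C M M" using s(1) p by simp
    ultimately show ?case by blast
  qed
  from this[of k] obtain s where "s \<in> mor C M M" "?d \<bullet> s = ident C M \<ominus>\<^bsub>Hom C M M\<^esub> zero_mor C M M"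
    "s \<bullet> ?d = ident C M \<ominus>\<^bsub>Hom C M M\<^esub> zero_mor C M M" using nil by auto
  moreover have "ident C M \<ominus>\<^bsub>Hom C M M\<^esub> zero_mor C M M = ident C M"
    using ident_mor[of M] by (simp add: a_minus_def uminus_zero_mor)
  ultimately show ?thesis using d unfolding is_iso_def by auto
qed

end

context bounded_t_structure
begin

lemma cohom_null_nilpotent:
  assumes g: "\<gamma> \<in> mor C M M" and n: "\<And>m. cohom_null m M M \<gamma>"
  shows "\<exists>k. ((\<lambda>f. \<gamma> \<bullet> f) ^^ k) (ident C M) = zero_mor C M M"
proof -
  obtain a b where ab: "a \<le> b" "M \<in> t_ge C Tge a" "M \<in> t_le C Tle b" using t_bounded[of M] by blast
  \<comment> \<open>Each application of \<gamma> lowers the degree of the source by one, down to a -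
    1, from which nothing maps to M. The source varies in the induction because \<gamma> f factors
    through a new object \<open>L\<close>.\<close>
  have "((\<lambda>f. \<gamma> \<bullet> f) ^^ k) f = zero_mor C X M"
    if "X \<in> t_le C Tle (a - 1 + int k)" "f \<in> mor C X M" for X f k
    using that
  proof (induction k arbitrary: X f)
    case 0
    then have "orth X M" using orth_t[OF _ ab(2), of X "a - 1"] by simp
    then show ?case using 0 orthD by simp
  next
    case (Suc k)
    obtain L w \<delta> where L: "L \<in> t_le C Tle (a - 1 + int (Suc k) - 1)" "w \<in> mor C L M" "\<delta> \<in> mor C X L"
      "w \<bullet> \<delta> = \<gamma> \<bullet> f"
      by (rule cohom_null_factor[OF g n Suc.prems])
    have L1: "L \<in> t_le C Tle (a - 1 + int k)" using L(1) by (simp add: algebra_simps)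
    let ?p = "((\<lambda>f. \<gamma> \<bullet> f) ^^ k) (ident C M)"
    have p: "?p \<in> mor C M M" using funpow_cmp_eq(1)[OF g ident_mor] .
    have "((\<lambda>f. \<gamma> \<bullet> f) ^^ Suc k) f = ((\<lambda>f. \<gamma> \<bullet> f) ^^ k) (w \<bullet> \<delta>)" using L(4)
      by (simp add: funpow_Suc_right del: funpow.simps)
    also have "\<dots> = ?p \<bullet> (w \<bullet> \<delta>)" using funpow_cmp_eq(2)[OF g cmp_mor[OF L(3,2)]] by simp
    also have "\<dots> = (?p \<bullet> w) \<bullet> \<delta>" using cmp_assoc[OF L(3,2) p] by simp
    also have "?p \<bullet> w = zero_mor C L M"
      using funpow_cmp_eq(2)[OF g L(2), of k] Suc.IH[OF L1 L(2)] by simp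
    finally show ?case using cmp_zero_left[OF L(3)] by simp
  qed
  \<comment> \<open>For this exponent a - 1 + k = b, so the identity of M is an admissible
    \<open>f\<close>.\<close>
  from this[OF _ ident_mor, of "nat (b - a + 1)"] show ?thesis using ab by auto
qed

text \<open>Each \<beta> \<alpha> passes the same tests, because v \<beta> is again a test map on N;
  hence \<beta> \<alpha> is nilpotent.\<close>

lemma cohom_null_imp_radical:
  assumes a: "\<alpha> \<in> mor C M N" and n: "\<And>m. cohom_null m M N \<alpha>"
  shows "\<alpha> \<in> radical C M N"
  unfolding radical_def
proof (intro CollectI conjI ballI a)
  fix \<beta> assume b: "\<beta> \<in> mor C N M"
  have g: "\<beta> \<bullet> \<alpha> \<in> mor C M M" using cmp_mor[OF a b] .
  have "cohom_null m M M (\<beta> \<bullet> \<alpha>)" for m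
    unfolding cohom_null_def
  proof (intro ballI)
    fix X Y u v
    assume X: "X \<in> t_le C Tle m" and Y: "Y \<in> t_ge C Tge m" and u: "u \<in> mor C X M" and v: "v \<in> mor C M Y"
    have "v \<bullet> ((\<beta> \<bullet> \<alpha>) \<bullet> u) = (v \<bullet> \<beta>) \<bullet> (\<alpha> \<bullet> u)"
      using cmp_assoc[OF u a b] cmp_assoc[OF cmp_mor[OF u a] b v] by simp
    then show "v \<bullet> ((\<beta> \<bullet> \<alpha>) \<bullet> u) = zero_mor C X Y"
      using cohom_nullD[OF n X Y u cmp_mor[OF b v]] by simp
  qed
  then show "is_iso C M M (ident C M \<ominus>\<^bsub>Hom C M M\<^esub> \<beta> \<bullet> \<alpha>)"
    using cohom_null_nilpotent[OF g] ident_minus_nilpotent_iso[OF g] by blast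
qed

end

section \<open>The radical\<close>

context linear_category
begin

lemma add_minus_cancel:
  assumes "f \<in> mor C X Y" "g \<in> mor C X Y"
  shows "(f \<ominus>\<^bsub>Hom C X Y\<^esub> g) \<oplus>\<^bsub>Hom C X Y\<^esub> g = f"
  using assms by (simp add: a_minus_def hom.a_assoc hom.l_neg)

text \<open>If \<open>c\<close> inverts \<open>1 - b a\<close>, then \<open>1 + a c b\<close> inverts \<open>1 - a b\<close>.\<close>
lemma ident_minus_cmp_iso_swap:
  assumes a: "a \<in> mor C M X" and b: "b \<in> mor C X M"
    and i: "is_iso C M M (ident C M \<ominus>\<^bsub>Hom C M M\<^esub> b \<bullet> a)"
  shows "is_iso C X X (ident C X \<ominus>\<^bsub>Hom C X X\<^esub> a \<bullet> b)"
proof -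
  let ?d = "ident C M \<ominus>\<^bsub>Hom C M M\<^esub> b \<bullet> a" and ?e = "ident C X \<ominus>\<^bsub>Hom C X X\<^esub> a \<bullet> b"
  obtain c where c: "c \<in> mor C M M" "c \<bullet> ?d = ident C M" "?d \<bullet> c = ident C M"
    using i unfolding is_iso_def by blast
  have ba: "b \<bullet> a \<in> mor C M M" and ab: "a \<bullet> b \<in> mor C X X" using cmp_mor a b by blast+
  have d: "?d \<in> mor C M M" and e: "?e \<in> mor C X X" using ba ab ident_mor by simp_all
  have cb: "c \<bullet> b \<in> mor C X M" using cmp_mor b c by blast
  let ?acb = "a \<bullet> (c \<bullet> b)"
  have acb: "?acb \<in> mor C X X" using cmp_mor a cb by blast
  have ea: "?e \<bullet> a = a \<bullet> ?d"
    using cmp_minus_left[OF a ident_mor ab] cmp_minus_right[OF ident_mor ba a]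
      cmp_assoc[OF a b a] ident_left[OF a] ident_right[OF a] by simp
  have be: "b \<bullet> ?e = ?d \<bullet> b"
    using cmp_minus_left[OF b ident_mor ba] cmp_minus_right[OF ident_mor ab b]
      cmp_assoc[OF b a b] ident_left[OF b] ident_right[OF b] by simp
  have "?e \<bullet> ?acb = (?e \<bullet> a) \<bullet> (c \<bullet> b)" using cmp_assoc[OF cb a e] by simp
  also have "\<dots> = a \<bullet> ((?d \<bullet> c) \<bullet> b)"
    unfolding ea using cmp_assoc[OF cb d a] cmp_assoc[OF b c(1) d] by simp
  finally have 1: "?e \<bullet> ?acb = a \<bullet> b" using c(3) ident_left[OF b] by simp
  have "?acb \<bullet> ?e = a \<bullet> (c \<bullet> (b \<bullet> ?e))"
    using cmp_assoc[OF e cb a] cmp_assoc[OF e b c(1)] by simp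
  also have "\<dots> = a \<bullet> ((c \<bullet> ?d) \<bullet> b)"
    unfolding be using cmp_assoc[OF b d c(1)] by simp
  finally have 2: "?acb \<bullet> ?e = a \<bullet> b" using c(2) ident_left[OF b] by simp
  let ?i = "ident C X \<oplus>\<^bsub>Hom C X X\<^esub> ?acb"
  have "?e \<bullet> ?i = ident C X"
    using cmp_add_right[OF ident_mor acb e] ident_right[OF e] 1 add_minus_cancel[OF ident_mor ab] by simp
  moreover have "?i \<bullet> ?e = ident C X"
    using cmp_add_left[OF e ident_mor acb] ident_left[OF e] 2 add_minus_cancel[OF ident_mor ab] by simp
  moreover have "?i \<in> mor C X X" using acb ident_mor by simp
  ultimately show ?thesis using e unfolding is_iso_def by blast
qed

lemma radicalD:
  assumes "\<alpha> \<in> radical C M N"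
  shows "\<alpha> \<in> mor C M N"
    and "\<beta> \<in> mor C N M \<Longrightarrow> is_iso C M M (ident C M \<ominus>\<^bsub>Hom C M M\<^esub> \<beta> \<bullet> \<alpha>)"
  using assms unfolding radical_def by auto

text \<open>The radical is a two-sided ideal: by the swap lemma, 1 - (\<beta> g \<alpha>) f is
  invertible because 1 - (f \<beta> g) \<alpha> is, and the latter tests \<alpha> with f \<beta>
  g.\<close>

lemma radical_cmp:
  assumes a: "\<alpha> \<in> radical C M N" and f: "f \<in> mor C X M" and g: "g \<in> mor C N Y"
  shows "g \<bullet> (\<alpha> \<bullet> f) \<in> radical C X Y"
  unfolding radical_def
proof (intro CollectI conjI ballI)
  have m: "\<alpha> \<in> mor C M N" using radicalD(1)[OF a] .
  show "g \<bullet> (\<alpha> \<bullet> f) \<in> mor C X Y" using cmp_mor[OF cmp_mor[OF f m] g] .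
  fix \<beta> assume b: "\<beta> \<in> mor C Y X"
  let ?a = "(\<beta> \<bullet> g) \<bullet> \<alpha>"
  have bg: "\<beta> \<bullet> g \<in> mor C N X" using cmp_mor[OF g b] .
  have "is_iso C M M (ident C M \<ominus>\<^bsub>Hom C M M\<^esub> f \<bullet> ?a)"
    using radicalD(2)[OF a cmp_mor[OF bg f]] cmp_assoc[OF m bg f] by simp
  then have "is_iso C X X (ident C X \<ominus>\<^bsub>Hom C X X\<^esub> ?a \<bullet> f)"
    using ident_minus_cmp_iso_swap[OF cmp_mor[OF m bg] f] by simp
  moreover have "?a \<bullet> f = \<beta> \<bullet> (g \<bullet> (\<alpha> \<bullet> f))"
    using cmp_assoc[OF f m bg] cmp_assoc[OF cmp_mor[OF f m] g b] by simp
  ultimately show "is_iso C X X (ident C X \<ominus>\<^bsub>Hom C X X\<^esub> \<beta> \<bullet> (g \<bullet> (\<alpha> \<bullet> f)))" by simp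
qed

text \<open>The composite of 1 - \<psi> \<phi> followed by \<phi> is zero, and its first factor is
  invertible.\<close>

lemma radical_regular_eq_zero:
  assumes r: "\<phi> \<in> radical C X Y" and p: "\<psi> \<in> mor C Y X" and reg: "\<phi> \<bullet> (\<psi> \<bullet> \<phi>) = \<phi>"
  shows "\<phi> = zero_mor C X Y"
proof -
  have m: "\<phi> \<in> mor C X Y" using radicalD(1)[OF r] .
  have e: "\<psi> \<bullet> \<phi> \<in> mor C X X" using cmp_mor[OF m p] .
  let ?d = "ident C X \<ominus>\<^bsub>Hom C X X\<^esub> \<psi> \<bullet> \<phi>"
  obtain c where c: "c \<in> mor C X X" "?d \<bullet> c = ident C X"
    using radicalD(2)[OF r p] unfolding is_iso_def by blast
  have d: "?d \<in> mor C X X" using e ident_mor by simp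
  have z: "\<phi> \<bullet> ?d = zero_mor C X Y"
    using cmp_minus_right[OF ident_mor e m] reg ident_right[OF m] minus_zero_iff[OF m m] by simp
  have "\<phi> = \<phi> \<bullet> (?d \<bullet> c)" using c(2) ident_right[OF m] by simp
  also have "\<dots> = zero_mor C X Y" using cmp_assoc[OF c(1) d m] z cmp_zero_left[OF c(1)] by simp
  finally show ?thesis .
qed

text \<open>Semi-simplicity speaks of short exact sequences, so \<open>f\<close> has to be the
  kernel of its own cokernel, while \<open>abelian_subcategory\<close> presents it as a kernel of
  some \<open>g\<close>. Since \<open>g\<close> factors through \<open>q\<close>, whatever
  \<open>q\<close> kills is killed by \<open>g\<close>.\<close>

lemma semisimple_monomorphism_splits:
  assumes ab: "abelian_subcategory C S" and ss: "semisimple_subcategory C S"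
    and XY: "X \<in> S" "Y \<in> S" and mono: "is_monomorphism C S X Y f"
  obtains Q q r s where "Q \<in> S" "is_cokernel C S X Y f Q q" "is_biproduct C X Q Y f s r q"
proof -
  have f: "f \<in> mor C X Y" using mono unfolding is_monomorphism_def by blast
  obtain Q q where q: "is_cokernel C S X Y f Q q"
    using ab XY f unfolding abelian_subcategory_def by meson
  obtain Z g where Z: "Z \<in> S" "g \<in> mor C Y Z" "is_kernel C S Y Z g X f"
    using ab XY mono unfolding abelian_subcategory_def by meson
  have Q: "Q \<in> S" "q \<in> mor C Y Q" "q \<bullet> f = zero_mor C X Q" using q unfolding is_cokernel_def by auto
  have "g \<bullet> f = zero_mor C X Z" using Z unfolding is_kernel_def by blast
  then obtain t where t: "t \<in> mor C Q Z" "t \<bullet> q = g"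
    using q Z(1,2) unfolding is_cokernel_def by meson
  have "is_kernel C S Y Q q X f"
    unfolding is_kernel_def
  proof (intro conjI ballI impI XY f Q)
    fix W u assume W: "W \<in> S" "u \<in> mor C W Y" "q \<bullet> u = zero_mor C W Q"
    then have "g \<bullet> u = zero_mor C W Z"
      using cmp_assoc[OF W(2) Q(2) t(1)] t(2) cmp_zero_right[OF t(1)] by simp
    then show "\<exists>!v. v \<in> mor C W X \<and> f \<bullet> v = u" using Z(3) W unfolding is_kernel_def by blast
  qed
  then have "short_exact C S X Y Q f q" unfolding short_exact_def using XY Q(1) q by blast
  then obtain r s where "is_biproduct C X Q Y f s r q"
    using ss unfolding semisimple_subcategory_def by blast
  then show thesis using that Q(1) q by blast
qed

text \<open>\<phi> is a split epimorphism onto its coimage followed by a split monomorphism; \<psi>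
  composes the two splittings in the opposite direction.\<close>

lemma semisimple_regular:
  assumes ab: "abelian_subcategory C S" and ss: "semisimple_subcategory C S"
    and XY: "X \<in> S" "Y \<in> S" and p: "\<phi> \<in> mor C X Y"
  obtains \<psi> where "\<psi> \<in> mor C Y X" "\<phi> \<bullet> (\<psi> \<bullet> \<phi>) = \<phi>"
proof -
  obtain K k where K: "is_kernel C S X Y \<phi> K k"
    using ab XY p unfolding abelian_subcategory_def by meson
  have k: "K \<in> S" "k \<in> mor C K X" "\<phi> \<bullet> k = zero_mor C K Y" using K unfolding is_kernel_def by auto
  have "is_monomorphism C S K X k"
    unfolding is_monomorphism_def
  proof (intro conjI ballI impI k)
    fix W g h assume W: "W \<in> S" "g \<in> mor C W K" "h \<in> mor C W K" "k \<bullet> g = k \<bullet> h"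
    have "\<phi> \<bullet> (k \<bullet> g) = zero_mor C W Y"
      using cmp_assoc[OF W(2) k(2) p] k(3) cmp_zero_left[OF W(2)] by simp
    then have "\<exists>!u. u \<in> mor C W K \<and> k \<bullet> u = k \<bullet> g"
      using K W(1) cmp_mor[OF W(2) k(2)] unfolding is_kernel_def by blast
    then show "g = h" using W by metis
  qed
  from semisimple_monomorphism_splits[OF ab ss k(1) XY(1) this]
  obtain Q q r s where Q: "Q \<in> S" "is_cokernel C S K X k Q q" and bi: "is_biproduct C K Q X k s r q" .
  have q: "q \<in> mor C X Q" "s \<in> mor C Q X" "q \<bullet> s = ident C Q" "q \<bullet> k = zero_mor C K Q"
    using bi unfolding is_biproduct_def by auto
  obtain \<phi>' where p': "\<phi>' \<in> mor C Q Y" "\<phi>' \<bullet> q = \<phi>"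
    using Q(2) XY(2) p k(3) unfolding is_cokernel_def by meson
  \<comment> \<open>A difference killed by \<open>\<phi>'\<close> is carried by \<open>s\<close> to
    X, where \<phi> kills it; so it comes from \<open>K\<close> and dies under
    \<open>q\<close>.\<close>
  have "is_monomorphism C S Q Y \<phi>'"
    unfolding is_monomorphism_def
  proof (intro conjI ballI impI p')
    fix W g h assume W: "W \<in> S" "g \<in> mor C W Q" "h \<in> mor C W Q" "\<phi>' \<bullet> g = \<phi>' \<bullet> h"
    let ?d = "g \<ominus>\<^bsub>Hom C W Q\<^esub> h"
    have d: "?d \<in> mor C W Q" using W by simp
    have sd: "s \<bullet> ?d \<in> mor C W X" using cmp_mor[OF d q(2)] .
    have qsd: "q \<bullet> (s \<bullet> ?d) = ?d" using cmp_assoc[OF d q(2,1)] q(3) ident_left[OF d] by simp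
    have "\<phi>' \<bullet> ?d = zero_mor C W Y"
      using cmp_minus_right[OF W(2,3) p'(1)] W(4) minus_zero_iff[OF cmp_mor[OF W(3) p'(1)] cmp_mor[OF W(3) p'(1)]]
      by simp
    then have "\<phi> \<bullet> (s \<bullet> ?d) = zero_mor C W Y"
      using cmp_assoc[OF sd q(1) p'(1)] p'(2) qsd by simp
    then obtain u where u: "u \<in> mor C W K" "k \<bullet> u = s \<bullet> ?d"
      using K W(1) sd unfolding is_kernel_def by blast
    have "?d = (q \<bullet> k) \<bullet> u" using qsd u cmp_assoc[OF u(1) k(2) q(1)] by simp
    then have "?d = zero_mor C W Q" using q(4) cmp_zero_left[OF u(1)] by simp
    then show "g = h" using minus_zero_iff[OF W(2,3)] by simp
  qed
  from semisimple_monomorphism_splits[OF ab ss Q(1) XY(2) this]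
  obtain Q' q' r' s' where bi': "is_biproduct C Q Q' Y \<phi>' s' r' q'" .
  have r': "r' \<in> mor C Y Q" "r' \<bullet> \<phi>' = ident C Q" using bi' unfolding is_biproduct_def by auto
  show thesis
  proof
    show sr: "s \<bullet> r' \<in> mor C Y X" using cmp_mor[OF r'(1) q(2)] .
    have "(s \<bullet> r') \<bullet> \<phi> = s \<bullet> (r' \<bullet> (\<phi>' \<bullet> q))"
      using cmp_assoc[OF p r'(1) q(2)] p'(2) by simp
    also have "\<dots> = s \<bullet> q" using cmp_assoc[OF q(1) p'(1) r'(1)] r'(2) ident_left[OF q(1)] by simp
    finally have e: "(s \<bullet> r') \<bullet> \<phi> = s \<bullet> q" .
    have "\<phi> \<bullet> (s \<bullet> q) = \<phi>' \<bullet> (q \<bullet> (s \<bullet> q))"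
      using cmp_assoc[OF cmp_mor[OF q(1,2)] q(1) p'(1)] p'(2) by simp
    also have "\<dots> = \<phi>" using cmp_assoc[OF q(1,2,1)] q(3) ident_left[OF q(1)] p'(2) by simp
    finally show "\<phi> \<bullet> ((s \<bullet> r') \<bullet> \<phi>) = \<phi>" using e by simp
  qed
qed

lemma semisimple_radical_eq_zero:
  assumes "abelian_subcategory C S" "semisimple_subcategory C S" "X \<in> S" "Y \<in> S" "\<phi> \<in> radical C X Y"
  shows "\<phi> = zero_mor C X Y"
  using semisimple_regular[OF assms(1-4) radicalD(1)[OF assms(5)]] radical_regular_eq_zero[OF assms(5)] by metis

lemma radical_zero_biproduct_left:
  assumes bi: "is_biproduct C X Y B i j p q" and r: "\<phi> \<in> radical C B W"
    and "\<And>\<phi>. \<phi> \<in> radical C X W \<Longrightarrow> \<phi> = zero_mor C X W"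
    and "\<And>\<phi>. \<phi> \<in> radical C Y W \<Longrightarrow> \<phi> = zero_mor C Y W"
  shows "\<phi> = zero_mor C B W"
proof -
  have b: "i \<in> mor C X B" "j \<in> mor C Y B" "p \<in> mor C B X" "q \<in> mor C B Y"
    "(i \<bullet> p) \<oplus>\<^bsub>Hom C B B\<^esub> (j \<bullet> q) = ident C B" using bi unfolding is_biproduct_def by auto
  have m: "\<phi> \<in> mor C B W" using radicalD(1)[OF r] .
  have "\<phi> \<bullet> i = zero_mor C X W"
    using radical_cmp[OF r b(1) ident_mor] ident_left[OF cmp_mor[OF b(1) m]] assms(3) by simp
  moreover have "\<phi> \<bullet> j = zero_mor C Y W"
    using radical_cmp[OF r b(2) ident_mor] ident_left[OF cmp_mor[OF b(2) m]] assms(4) by simp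
  moreover have "\<phi> = ((\<phi> \<bullet> i) \<bullet> p) \<oplus>\<^bsub>Hom C B W\<^esub> ((\<phi> \<bullet> j) \<bullet> q)"
    using cmp_add_right[OF cmp_mor[OF b(3,1)] cmp_mor[OF b(4,2)] m] b(5) ident_right[OF m]
      cmp_assoc[OF b(3,1) m] cmp_assoc[OF b(4,2) m] by simp
  ultimately show ?thesis using cmp_zero_left[OF b(3)] cmp_zero_left[OF b(4)] by simp
qed

lemma radical_zero_biproduct_right:
  assumes bi: "is_biproduct C X Y B i j p q" and r: "\<phi> \<in> radical C W B"
    and "\<And>\<phi>. \<phi> \<in> radical C W X \<Longrightarrow> \<phi> = zero_mor C W X"
    and "\<And>\<phi>. \<phi> \<in> radical C W Y \<Longrightarrow> \<phi> = zero_mor C W Y"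
  shows "\<phi> = zero_mor C W B"
proof -
  have b: "i \<in> mor C X B" "j \<in> mor C Y B" "p \<in> mor C B X" "q \<in> mor C B Y"
    "(i \<bullet> p) \<oplus>\<^bsub>Hom C B B\<^esub> (j \<bullet> q) = ident C B" using bi unfolding is_biproduct_def by auto
  have m: "\<phi> \<in> mor C W B" using radicalD(1)[OF r] .
  have "p \<bullet> \<phi> = zero_mor C W X"
    using radical_cmp[OF r ident_mor b(3)] ident_right[OF m] assms(3) by simp
  moreover have "q \<bullet> \<phi> = zero_mor C W Y"
    using radical_cmp[OF r ident_mor b(4)] ident_right[OF m] assms(4) by simp
  moreover have "\<phi> = (i \<bullet> (p \<bullet> \<phi>)) \<oplus>\<^bsub>Hom C W B\<^esub> (j \<bullet> (q \<bullet> \<phi>))"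
    using cmp_add_left[OF m cmp_mor[OF b(3,1)] cmp_mor[OF b(4,2)]] b(5) ident_left[OF m]
      cmp_assoc[OF m b(3,1)] cmp_assoc[OF m b(4,2)] by simp
  ultimately show ?thesis using cmp_zero_right[OF b(1)] cmp_zero_right[OF b(2)] by simp
qed

end

context triangulated_category
begin

lemma radical_shift:
  assumes r: "\<alpha> \<in> radical C M N"
  shows "shift_mor C n \<alpha> \<in> radical C (shift C n M) (shift C n N)"
  unfolding radical_def
proof (intro CollectI conjI ballI)
  have a: "\<alpha> \<in> mor C M N" using radicalD(1)[OF r] .
  show "shift_mor C n \<alpha> \<in> mor C (shift C n M) (shift C n N)" using shift_mor_mor[OF a] .
  fix \<beta> assume "\<beta> \<in> mor C (shift C n N) (shift C n M)"
  then obtain b where b: "b \<in> mor C N M" "shift_mor C n b = \<beta>" by (rule shift_mor_surj)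
  have ba: "b \<bullet> \<alpha> \<in> mor C M M" using cmp_mor[OF a b(1)] .
  let ?d = "ident C M \<ominus>\<^bsub>Hom C M M\<^esub> b \<bullet> \<alpha>"
  obtain c where c: "c \<in> mor C M M" "?d \<in> mor C M M" "c \<bullet> ?d = ident C M" "?d \<bullet> c = ident C M"
    using radicalD(2)[OF r b(1)] unfolding is_iso_def by blast
  have "is_iso C (shift C n M) (shift C n M) (shift_mor C n ?d)"
    unfolding is_iso_def
    using shift_mor_mor[OF c(1)] shift_mor_mor[OF c(2)] shift_cmp[OF c(1,2)] shift_cmp[OF c(2,1)] c(3,4)
    by (metis shift_ident)
  then show "is_iso C (shift C n M) (shift C n M)
      (ident C (shift C n M) \<ominus>\<^bsub>Hom C (shift C n M) (shift C n M)\<^esub> \<beta> \<bullet> shift_mor C n \<alpha>)"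
    using shift_mor_minus[OF ident_mor ba] shift_cmp[OF a b(1)] b(2) by (simp add: shift_ident)
qed

lemma is_extension_split:
  assumes "is_extension X Y Z" "orth Z (shift C 1 X)"
  obtains i j p q where "is_biproduct C X Z Y i j p q"
proof -
  obtain f g h where t: "dist_tri C X Y Z f g h" using assms(1) by (rule is_extensionE)
  have "h = zero_mor C Z (shift C 1 X)" using orthD[OF assms(2)] tri_mor[OF t] by blast
  then show thesis using split_triangle t that by blast
qed

text \<open>Devissage in the second argument requires it unshifted, so the shift is moved to the
  first argument and then back.\<close>

lemma orth_extension_closure_shift:
  assumes "X \<in> extension_closure C S" "Z \<in> extension_closure C T"
    and o: "\<And>X Z. X \<in> S \<Longrightarrow> Z \<in> T \<Longrightarrow> orth Z (shift C n X)"
  shows "orth Z (shift C n X)"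
proof -
  have "orth (shift C (- n) Z') X" if "Z' \<in> T" for Z'
  proof (rule orth_extension_closure_right[OF assms(1)])
    fix X' assume "X' \<in> S"
    then show "orth (shift C (- n) Z') X'" using o[OF _ that] orth_shift[of "- n" Z' "shift C n X'"] by simp
  qed
  then have "orth Z' (shift C n X)" if "Z' \<in> T" for Z'
    using that orth_shift[of "- n" Z' "shift C n X"] by simp
  then show ?thesis using orth_extension_closure_left[OF assms(2)] by blast
qed

text \<open>Without extensions between members of S every triangle in the closure splits, so its
  objects are iterated biproducts and the claim is checked on components, first in the source and
  then in the target.\<close>

lemma radical_extension_closure_eq_zero:
  assumes r: "\<And>X Y \<phi>. \<lbrakk>X \<in> S; Y \<in> S; \<phi> \<in> radical C X Y\<rbrakk> \<Longrightarrow> \<phi> = zero_mor C X Y"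
    and o: "\<And>X Y. \<lbrakk>X \<in> S; Y \<in> S\<rbrakk> \<Longrightarrow> orth X (shift C 1 Y)"
    and E: "E \<in> extension_closure C S" and G: "G \<in> extension_closure C S"
    and p: "\<phi> \<in> radical C E G"
  shows "\<phi> = zero_mor C E G"
proof -
  have o': "orth Z (shift C 1 X)" if "X \<in> extension_closure C S" "Z \<in> extension_closure C S" for X Z
    using orth_extension_closure_shift[OF that] o by blast
  have left: "\<forall>\<phi> \<in> radical C E Y. \<phi> = zero_mor C E Y" if Y: "Y \<in> S" for Y
    using E
  proof (induction rule: extension_closure_induct)
    case (zero X)
    then show ?case using orth_zero_left orthD radicalD(1) by blast
  next
    case (extension X B Z)
    obtain i j p q where bi: "is_biproduct C X Z B i j p q"
      using is_extension_split[OF extension.hyps(3) o'[OF extension.hyps(1,2)]] .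
    show ?case
      by (intro ballI radical_zero_biproduct_left[OF bi]) (use extension.IH in blast)+
  qed (use r Y in blast)
  have "\<forall>\<phi> \<in> radical C E G. \<phi> = zero_mor C E G"
    using G
  proof (induction rule: extension_closure_induct)
    case (zero X)
    then show ?case using orth_zero_right orthD radicalD(1) by blast
  next
    case (extension X B Z)
    obtain i j p q where bi: "is_biproduct C X Z B i j p q"
      using is_extension_split[OF extension.hyps(3) o'[OF extension.hyps(1,2)]] .
    show ?case
      by (intro ballI radical_zero_biproduct_right[OF bi]) (use extension.IH in blast)+
  qed (use left in blast)
  then show ?thesis using p by blast
qed

end

section \<open>Weights and truncations for transversal structures\<close>

locale transversal_structures =
  bounded_weight_structure F C Wle Wge + bounded_t_structure F C Tle Tge
  for F :: "('f, 'r) ring_scheme" and C :: "('f, 'o, 'm, 'z) tricat_scheme" (structure)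
    and Wle Wge Tle Tge :: "'o set" +
  fixes A :: "int \<Rightarrow> 'o set"
  assumes A_abelian: "abelian_subcategory C (A i)"
    and A_semisimple: "semisimple_subcategory C (A i)"
    and A_orthogonal: "\<lbrakk>s < 0 \<or> s > i - j \<or> (s = 0 \<and> i \<noteq> j); X \<in> A i; Y \<in> A j\<rbrakk> \<Longrightarrow>
      mor C X (shift C s Y) = {zero_mor C X (shift C s Y)}"
    and heart_eq: "heart Tle Tge = extension_closure C (\<Union>i. A i)"
    and w_heart_eq: "w_le C Wle 0 \<inter> w_ge C Wge 0 = finite_sums C (\<Union>i. shift C (- i) ` A i)"
begin

lemma orth_A: "\<lbrakk>i \<noteq> j; X \<in> A i; Y \<in> A j\<rbrakk> \<Longrightarrow> orth X Y"
  using A_orthogonal[of 0 i j X Y] by (simp add: orth_iff)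

lemma orth_A_shift_1: "\<lbrakk>i \<le> j; X \<in> A i; Y \<in> A j\<rbrakk> \<Longrightarrow> orth X (shift C 1 Y)"
  using A_orthogonal[of 1 i j X Y] by (simp add: orth_iff)

lemma A_weight:
  assumes "X \<in> A i"
  shows "X \<in> w_le C Wle i" "X \<in> w_ge C Wge i"
proof -
  let ?Y = "shift C (- i) X"
  obtain Z where Z: "zero_object C UNIV Z" using ex_zero by blast
  \<comment> \<open>\<open>finite_sums\<close> starts from a zero object, so a single summand has to
    be presented as a biproduct with it.\<close>
  have bi: "is_biproduct C Z ?Y ?Y (zero_mor C Z ?Y) (ident C ?Y) (zero_mor C ?Y Z) (ident C ?Y)"
    unfolding is_biproduct_def
  proof (intro conjI)
    show "zero_mor C ?Y Z \<bullet> zero_mor C Z ?Y = ident C Z"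
      using cmp_zero_left[of "zero_mor C Z ?Y" Z ?Y Z] Z by (simp add: zero_object_iff)
    show "(zero_mor C Z ?Y \<bullet> zero_mor C ?Y Z) \<oplus>\<^bsub>Hom C ?Y ?Y\<^esub> (ident C ?Y \<bullet> ident C ?Y) = ident C ?Y"
      using cmp_zero_left[of "zero_mor C ?Y Z" ?Y Z ?Y] ident_left[OF ident_mor] ident_mor[of ?Y] by simp
  qed (simp_all add: ident_mor ident_left[OF ident_mor] ident_left[OF hom.zero_closed] ident_right[OF hom.zero_closed])
  have "?Y \<in> finite_sums C (\<Union>i. shift C (- i) ` A i)"
    by (rule finite_sums.step[OF finite_sums.empty[OF Z] _ bi]) (use assms in blast)
  then have "?Y \<in> w_le C Wle 0 \<inter> w_ge C Wge 0" using w_heart_eq by simp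
  then show "X \<in> w_le C Wle i" "X \<in> w_ge C Wge i" by (simp_all add: shift_mem_w_le shift_mem_w_ge)
qed

text \<open>The objects of the heart whose weights lie in \<open>I\<close>.\<close>
definition heart_of :: "int set \<Rightarrow> 'o set" where
  "heart_of I = extension_closure C (\<Union>i\<in>I. A i)"

lemma heart_of_UNIV: "heart_of UNIV = heart Tle Tge"
  by (simp add: heart_of_def heart_eq)

lemma heart_of_mono: "I \<subseteq> J \<Longrightarrow> heart_of I \<subseteq> heart_of J"
  unfolding heart_of_def by (rule subsetI, erule extension_closure_mono[rotated]) blast

lemma A_subset_heart_of: "i \<in> I \<Longrightarrow> A i \<subseteq> heart_of I"
  unfolding heart_of_def by (intro subsetI extension_closure.base) blast

lemma heart_of_t:
  assumes "X \<in> heart_of I"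
  shows "X \<in> t_le C Tle 0" "X \<in> t_ge C Tge 0"
  using assms heart_of_mono[of I UNIV] by (auto simp: heart_of_UNIV mem_heart_iff)

lemma heart_of_w_ge: "X \<in> heart_of I \<Longrightarrow> I \<subseteq> {k..} \<Longrightarrow> X \<in> w_ge C Wge k"
  unfolding heart_of_def
  by (rule extension_closure_w_ge) (auto intro: w_ge_mono_ge[OF _ A_weight(2)])

lemma heart_of_w_le: "X \<in> heart_of I \<Longrightarrow> I \<subseteq> {..k} \<Longrightarrow> X \<in> w_le C Wle k"
  unfolding heart_of_def
  by (rule extension_closure_w_le) (auto intro: w_le_mono_le[OF _ A_weight(1)])

lemma orth_heart_of:
  assumes "X \<in> heart_of I" "Y \<in> heart_of J" "I \<inter> J = {}"
  shows "orth X Y"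
proof -
  have "orth X' Y" if X': "X' \<in> (\<Union>i\<in>I. A i)" for X'
  proof (rule orth_extension_closure_right[OF assms(2)[unfolded heart_of_def]])
    fix Y' assume "Y' \<in> (\<Union>j\<in>J. A j)"
    then obtain i j where ij: "i \<in> I" "X' \<in> A i" "j \<in> J" "Y' \<in> A j" using X' by blast
    then have "i \<noteq> j" using assms(3) by blast
    then show "orth X' Y'" using orth_A ij by blast
  qed
  then show ?thesis by (rule orth_extension_closure_left[OF assms(1)[unfolded heart_of_def]])
qed

lemma heart_of_extension:
  "\<lbrakk>is_extension X Y Z; X \<in> heart_of I; Z \<in> heart_of I\<rbrakk> \<Longrightarrow> Y \<in> heart_of I"
  unfolding heart_of_def by (rule extension_closure_extension)

lemma zero_mem_heart_of: "zero_object C UNIV Z \<Longrightarrow> Z \<in> heart_of I"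
  unfolding heart_of_def by (rule extension_closure.zero)

text \<open>Hom(A_j, A_i[1]) = 0 for j < k \<le> i, so a low-weight piece can be moved past a
  high-weight piece that precedes it. In an extension of two filtered objects this collects all
  weights < k in the subobject.\<close>

lemma weight_filtration:
  assumes "E \<in> heart_of I"
  shows "\<exists>P Q. is_extension P E Q \<and> P \<in> heart_of (I \<inter> {..<k}) \<and> Q \<in> heart_of (I \<inter> {k..})"
  using assms[unfolded heart_of_def]
proof (induction rule: extension_closure_induct)
  case (base X)
  then obtain i where i: "i \<in> I" "X \<in> A i" by blast
  obtain Z where Z: "zero_object C UNIV Z" using ex_zero by blast
  show ?case
  proof (cases "i < k")
    case True
    then have "X \<in> heart_of (I \<inter> {..<k})" using A_subset_heart_of[of i "I \<inter> {..<k}"] i by auto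
    then show ?thesis using is_extension_zero_right[OF Z] zero_mem_heart_of[OF Z] by blast
  next
    case False
    then have "X \<in> heart_of (I \<inter> {k..})" using A_subset_heart_of[of i "I \<inter> {k..}"] i by auto
    then show ?thesis using is_extension_zero_left[OF Z] zero_mem_heart_of[OF Z] by blast
  qed
next
  case (zero X)
  then show ?case using is_extension_zero_left[OF zero] zero_mem_heart_of[OF zero] by blast
next
  case (extension X Y Z)
  obtain P1 Q1 where 1: "is_extension P1 X Q1" "P1 \<in> heart_of (I \<inter> {..<k})" "Q1 \<in> heart_of (I \<inter> {k..})"
    using extension.IH by blast
  obtain P2 Q2 where 2: "is_extension P2 Z Q2" "P2 \<in> heart_of (I \<inter> {..<k})" "Q2 \<in> heart_of (I \<inter> {k..})"
    using extension.IH by blast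
  have "orth P2 (shift C 1 Q1)"
  proof (rule orth_extension_closure_shift[OF 1(3)[unfolded heart_of_def] 2(2)[unfolded heart_of_def]])
    fix X Z assume "X \<in> (\<Union>i\<in>I \<inter> {k..}. A i)" "Z \<in> (\<Union>i\<in>I \<inter> {..<k}. A i)"
    then obtain i j where "i \<ge> k" "X \<in> A i" "j < k" "Z \<in> A j" by auto
    then show "orth Z (shift C 1 X)" using orth_A_shift_1[of j i] by simp
  qed
  from extension_of_extensions[OF extension.hyps(3) 1(1) 2(1) this]
  obtain P Q where "is_extension P Y Q" "is_extension P1 P P2" "is_extension Q1 Q Q2" .
  then show ?case using 1 2 heart_of_extension by blast
qed

text \<open>If \<open>W\<^sub>k E\<close> is the weight \<open>< k\<close> part of \<open>E\<close>, then \<open>Hom(A\<^sub>i, W\<^sub>k E) \<subseteq> Hom(A\<^sub>i, E)\<close>.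
  Hence, by devissage in the first argument, \<open>Hom(W\<^sub>k E, W\<^sub>k E) = 0\<close>.\<close>
lemma heart_weights_geI:
  assumes E: "E \<in> heart_of UNIV" and o: "\<And>i X. \<lbrakk>i < k; X \<in> A i\<rbrakk> \<Longrightarrow> orth X E"
  shows "E \<in> heart_of {k..}"
proof -
  obtain P Q where PQ: "is_extension P E Q" "P \<in> heart_of {..<k}" "Q \<in> heart_of {k..}"
    using weight_filtration[OF E, of k] by auto
  have "orth X P" if X: "X \<in> (\<Union>i\<in>{..<k}. A i)" for X
  proof (rule orth_extension_right[OF is_extension_rotate_right[OF PQ(1)]])
    have "X \<in> heart_of {..<k}" using X A_subset_heart_of by blast
    then show "orth X (shift C (- 1) Q)"
      using orth_t[of X 0 "shift C (- 1) Q" 1] heart_of_t[of X] heart_of_t[OF PQ(3)]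
      by (simp add: shift_mem_t_ge)
    show "orth X E" using X o by blast
  qed
  then have "orth P P" by (rule orth_extension_closure_left[OF PQ(2)[unfolded heart_of_def]])
  then have "P \<in> heart_of {k..}" using zero_mem_heart_of orth_self_iff by blast
  then show ?thesis using heart_of_extension PQ by blast
qed

lemma heart_weights_leI:
  assumes E: "E \<in> heart_of UNIV" and o: "\<And>i X. \<lbrakk>i > k; X \<in> A i\<rbrakk> \<Longrightarrow> orth E X"
  shows "E \<in> heart_of {..k}"
proof -
  \<comment> \<open>The cut is made at k + 1 so that weight k stays in the subobject. Dually to
    \<open>heart_weights_geI\<close>, the quotient \<open>Q\<close> is shown to vanish.\<close>
  obtain P Q where PQ: "is_extension P E Q" "P \<in> heart_of {..<k + 1}" "Q \<in> heart_of {k + 1..}"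
    using weight_filtration[OF E, of "k + 1"] by auto
  have s: "{..<k + 1} = {..k}" by auto
  have "orth Q X" if X: "X \<in> (\<Union>i\<in>{k + 1..}. A i)" for X
  proof (rule orth_extension_left[OF is_extension_rotate_left[OF PQ(1)]])
    have "X \<in> heart_of {k + 1..}" using X A_subset_heart_of by blast
    then show "orth (shift C 1 P) X"
      using orth_t[of "shift C 1 P" "- 1" X 0] heart_of_t[of X] heart_of_t[OF PQ(2)]
      by (simp add: shift_mem_t_le)
    obtain i where "X \<in> A i" "i > k" using X by force
    then show "orth E X" using o by blast
  qed
  then have "orth Q Q" by (rule orth_extension_closure_right[OF PQ(3)[unfolded heart_of_def]])
  then have "Q \<in> heart_of {..k}" using zero_mem_heart_of orth_self_iff by blast
  then show ?thesis using heart_of_extension PQ unfolding s by blast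
qed

text \<open>\<open>d\<close> counts the degrees up to j in which M may have cohomology. The lowest
  cohomology object is peeled off first, because maps to it from objects in its own degree inject
  into maps to M, where the weight bound applies.\<close>

lemma w_ge_truncation_bounded:
  assumes "M \<in> w_ge C Wge k" "M \<in> t_ge C Tge (j + 1 - int d)"
  shows "\<exists>X Y. is_extension X M Y \<and> X \<in> t_le C Tle j \<and> Y \<in> t_ge C Tge (j + 1) \<and> X \<in> w_ge C Wge k"
  using assms
proof (induction d arbitrary: M)
  case 0
  obtain Z where Z: "zero_object C UNIV Z" using ex_zero by blast
  have "M \<in> t_ge C Tge (j + 1)" using 0 by simp
  then show ?case using is_extension_zero_left[OF Z] zero_mem_t_le[OF Z] zero_mem_w_ge[OF Z] by blast
next
  case (Suc d)
  define c where "c = j - int d"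
  have M: "M \<in> t_ge C Tge c" using Suc.prems(2) by (simp add: c_def)
  obtain L R where LR: "L \<in> t_le C Tle c" "R \<in> t_ge C Tge (c + 1)" "is_extension L M R"
    by (rule t_decomposition_at)
  have R': "shift C (- 1) R \<in> t_ge C Tge (c + 2)" using LR(2) by (simp add: shift_mem_t_ge add.commute)
  have rot: "is_extension (shift C (- 1) R) L M" using is_extension_rotate_right[OF LR(3)] .
  \<comment> \<open>Together with the choice of \<open>L\<close> this concentrates it in degree
    c.\<close>
  have "L \<in> t_ge C Tge c" using t_ge_extension[OF rot t_ge_mono_ge[OF _ R'] M] by simp
  then have "shift C c L \<in> heart_of UNIV"
    using LR(1) by (simp add: heart_of_UNIV mem_heart_iff shift_mem_t_le shift_mem_t_ge)
  \<comment> \<open>The shift by c raises weights by c. For i < k + c, the objects of A_i[-c] have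
    weight i - c < k and admit no nonzero map to M.\<close>
  then have "shift C c L \<in> heart_of {k + c..}"
  proof (rule heart_weights_geI)
    fix i X assume i: "i < k + c" and X: "X \<in> A i"
    have Xt: "shift C (- c) X \<in> t_le C Tle c"
      using heart_of_t(1) A_subset_heart_of[of i UNIV] X by (auto simp: shift_mem_t_le)
    have "orth (shift C (- c) X) M"
      by (rule orth_w[of _ "i - c" _ k]) (use A_weight(1)[OF X] Suc.prems(1) i in \<open>simp_all add: shift_mem_w_le\<close>)
    moreover have "orth (shift C (- c) X) (shift C (- 1) R)"
      by (rule orth_t[OF Xt R']) simp
    ultimately have "orth (shift C (- c) X) L" using orth_extension_right[OF rot] by blast
    then show "orth X (shift C c L)" using orth_shift[of c "shift C (- c) X" L] by simp
  qed
  then have L: "L \<in> w_ge C Wge k" using heart_of_w_ge by (fastforce simp: shift_mem_w_ge)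
  have "shift C 1 L \<in> w_ge C Wge k" by (simp add: shift_mem_w_ge w_ge_mono_ge[OF _ L])
  then have "R \<in> w_ge C Wge k"
    using w_ge_extension[OF is_extension_rotate_left[OF LR(3)] Suc.prems(1)] by blast
  moreover have "R \<in> t_ge C Tge (j + 1 - int d)" using LR(2) by (simp add: c_def algebra_simps)
  ultimately obtain X Y where XY: "is_extension X R Y" "X \<in> t_le C Tle j" "Y \<in> t_ge C Tge (j + 1)" "X \<in> w_ge C Wge k"
    using Suc.IH by blast
  \<comment> \<open>\<open>K\<close> is the preimage in M of the truncation of
    \<open>R\<close>.\<close>
  obtain K where K: "is_extension L K X" "is_extension K M Y" by (rule ex_middle_left[OF LR(3) XY(1)])
  have "L \<in> t_le C Tle j" by (rule t_le_mono_le[OF _ LR(1)]) (simp add: c_def)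
  then have "K \<in> t_le C Tle j" using t_le_extension[OF K(1)] XY(2) by blast
  moreover have "K \<in> w_ge C Wge k" using w_ge_extension[OF K(1) L XY(4)] .
  ultimately show ?case using K(2) XY(3) by blast
qed

lemma w_ge_truncation:
  assumes M: "M \<in> w_ge C Wge k"
  obtains X Y where "is_extension X M Y" "X \<in> t_le C Tle j" "Y \<in> t_ge C Tge (j + 1)" "X \<in> w_ge C Wge k"
    "Y \<in> w_ge C Wge k"
proof -
  obtain a where a: "M \<in> t_ge C Tge a" using t_bounded[of M] by blast
  \<comment> \<open>The index is the minimum of a and j + 1: \<open>nat\<close> returns 0 when M
    already lies above degree j.\<close>
  have "M \<in> t_ge C Tge (j + 1 - int (nat (j + 1 - a)))" by (rule t_ge_mono_ge[OF _ a]) simp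
  from w_ge_truncation_bounded[OF M this]
  obtain X Y where XY: "is_extension X M Y" "X \<in> t_le C Tle j" "Y \<in> t_ge C Tge (j + 1)" "X \<in> w_ge C Wge k"
    by blast
  have "shift C 1 X \<in> w_ge C Wge k" by (simp add: shift_mem_w_ge w_ge_mono_ge[OF _ XY(4)])
  then have "Y \<in> w_ge C Wge k" using w_ge_extension[OF is_extension_rotate_left[OF XY(1)] M] by blast
  then show thesis using that XY by blast
qed

text \<open>Dually, \<open>d\<close> counts the degrees above j, and the highest cohomology object
  \<open>R\<close> is peeled off first: maps from it to objects in its own degree inject into maps
  from N.\<close>

lemma w_le_truncation_bounded:
  assumes "N \<in> w_le C Wle k" "N \<in> t_le C Tle (j + int d)"
  shows "\<exists>X Y. is_extension X N Y \<and> X \<in> t_le C Tle j \<and> Y \<in> t_ge C Tge (j + 1) \<and> Y \<in> w_le C Wle k"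
  using assms
proof (induction d arbitrary: N)
  case 0
  obtain Z where Z: "zero_object C UNIV Z" using ex_zero by blast
  have "N \<in> t_le C Tle j" using 0 by simp
  then show ?case using is_extension_zero_right[OF Z] zero_mem_t_ge[OF Z] zero_mem_w_le[OF Z] by blast
next
  case (Suc d)
  define c where "c = j + int d + 1"
  have N: "N \<in> t_le C Tle c" using Suc.prems(2) by (simp add: c_def algebra_simps)
  obtain L R where LR: "L \<in> t_le C Tle (c - 1)" "R \<in> t_ge C Tge c" "is_extension L N R"
    using t_decomposition_at[of "c - 1" N] by auto
  have L': "shift C 1 L \<in> t_le C Tle (c - 2)" using LR(1) by (simp add: shift_mem_t_le)
  have rot: "is_extension N R (shift C 1 L)" using is_extension_rotate_left[OF LR(3)] .
  have "R \<in> t_le C Tle c" using t_le_extension[OF rot N t_le_mono_le[OF _ L']] by simp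
  then have "shift C c R \<in> heart_of UNIV"
    using LR(2) by (simp add: heart_of_UNIV mem_heart_iff shift_mem_t_le shift_mem_t_ge)
  then have "shift C c R \<in> heart_of {..k + c}"
  proof (rule heart_weights_leI)
    fix i X assume i: "i > k + c" and X: "X \<in> A i"
    have Xt: "shift C (- c) X \<in> t_ge C Tge c"
      using heart_of_t(2) A_subset_heart_of[of i UNIV] X by (auto simp: shift_mem_t_ge)
    have "orth N (shift C (- c) X)"
      by (rule orth_w[of _ k _ "i - c"]) (use A_weight(2)[OF X] Suc.prems(1) i in \<open>simp_all add: shift_mem_w_ge\<close>)
    moreover have "orth (shift C 1 L) (shift C (- c) X)"
      by (rule orth_t[OF L' Xt]) simp
    ultimately have "orth R (shift C (- c) X)" using orth_extension_left[OF rot] by blast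
    then show "orth (shift C c R) X" using orth_shift[of c R "shift C (- c) X"] by simp
  qed
  then have R: "R \<in> w_le C Wle k" using heart_of_w_le by (fastforce simp: shift_mem_w_le)
  have "shift C (- 1) R \<in> w_le C Wle (k - 1)" using R by (simp add: shift_mem_w_le)
  then have "shift C (- 1) R \<in> w_le C Wle k" by (rule w_le_mono_le[rotated]) simp
  then have "L \<in> w_le C Wle k"
    using w_le_extension[OF is_extension_rotate_right[OF LR(3)]] Suc.prems(1) by blast
  moreover have "L \<in> t_le C Tle (j + int d)" using LR(1) by (simp add: c_def)
  ultimately obtain X Y where XY: "is_extension X L Y" "X \<in> t_le C Tle j" "Y \<in> t_ge C Tge (j + 1)" "Y \<in> w_le C Wle k"
    using Suc.IH by blast
  obtain K where K: "is_extension X N K" "is_extension Y K R" by (rule ex_middle_right[OF LR(3) XY(1)])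
  have "R \<in> t_ge C Tge (j + 1)" by (rule t_ge_mono_ge[OF _ LR(2)]) (simp add: c_def)
  then have "K \<in> t_ge C Tge (j + 1)" using t_ge_extension[OF K(2)] XY(3) by blast
  moreover have "K \<in> w_le C Wle k" using w_le_extension[OF K(2) XY(4) R] .
  ultimately show ?case using K(1) XY(2) by blast
qed

lemma w_le_truncation:
  assumes N: "N \<in> w_le C Wle k"
  obtains X Y where "is_extension X N Y" "X \<in> t_le C Tle j" "Y \<in> t_ge C Tge (j + 1)" "X \<in> w_le C Wle k"
    "Y \<in> w_le C Wle k"
proof -
  obtain b where b: "N \<in> t_le C Tle b" using t_bounded[of N] by blast
  have "N \<in> t_le C Tle (j + int (nat (b - j)))" by (rule t_le_mono_le[OF _ b]) simp
  from w_le_truncation_bounded[OF N this]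
  obtain X Y where XY: "is_extension X N Y" "X \<in> t_le C Tle j" "Y \<in> t_ge C Tge (j + 1)" "Y \<in> w_le C Wle k"
    by blast
  have "shift C (- 1) Y \<in> w_le C Wle k" by (simp add: shift_mem_w_le w_le_mono_le[OF _ XY(4)])
  then have "X \<in> w_le C Wle k" using w_le_extension[OF is_extension_rotate_right[OF XY(1)]] N by blast
  then show thesis using that XY by blast
qed

end

section \<open>Radical morphisms vanish on cohomology\<close>

context transversal_structures
begin

lemma radical_imp_cohom_null_0:
  assumes M: "M \<in> w_ge C Wge k" and N: "N \<in> w_le C Wle k" and r: "\<alpha> \<in> radical C M N"
  shows "cohom_null 0 M N \<alpha>"
proof -
  have a: "\<alpha> \<in> mor C M N" using radicalD(1)[OF r] .
  \<comment> \<open>\<open>P\<close> and \<open>E\<close> play the roles of \<tau>^{\<le> 0} M and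
    H^0(M). N is truncated from below first, since \<open>Q\<close> has to receive a map from N;
    then \<open>G\<close> plays the role of H^0(N).\<close>
  obtain P R0 where P: "is_extension P M R0" "P \<in> t_le C Tle 0" "R0 \<in> t_ge C Tge (0 + 1)" "P \<in> w_ge C Wge k"
    by (rule w_ge_truncation[OF M])
  obtain L E where E: "is_extension L P E" "L \<in> t_le C Tle (- 1)" "E \<in> t_ge C Tge (- 1 + 1)"
    "L \<in> w_ge C Wge k" "E \<in> w_ge C Wge k"
    by (rule w_ge_truncation[OF P(4)])
  obtain L0 Q where Q: "is_extension L0 N Q" "L0 \<in> t_le C Tle (- 1)" "Q \<in> t_ge C Tge (- 1 + 1)" "Q \<in> w_le C Wle k"
    by (rule w_le_truncation[OF N])
  obtain G R where G: "is_extension G Q R" "G \<in> t_le C Tle 0" "R \<in> t_ge C Tge (0 + 1)"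
    "G \<in> w_le C Wle k" "R \<in> w_le C Wle k"
    by (rule w_le_truncation[OF Q(4)])

  have "shift C 1 L \<in> t_le C Tle 0" by (simp add: shift_mem_t_le t_le_mono_le[OF _ E(2)])
  then have "E \<in> t_le C Tle 0" using t_le_extension[OF is_extension_rotate_left[OF E(1)] P(2)] by blast
  then have "E \<in> heart_of UNIV" using E(3) by (simp add: heart_of_UNIV mem_heart_iff)
  then have E_geq: "E \<in> heart_of {k..}"
    by (rule heart_weights_geI) (rule orth_w[OF A_weight(1) E(5)])
  have "shift C (- 1) R \<in> t_ge C Tge 0" by (simp add: shift_mem_t_ge t_ge_mono_ge[OF _ G(3)])
  then have "G \<in> t_ge C Tge 0" using t_ge_extension[OF is_extension_rotate_right[OF G(1)]] Q(3) by simp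
  then have "G \<in> heart_of UNIV" using G(2) by (simp add: heart_of_UNIV mem_heart_iff)
  then have G_leq: "G \<in> heart_of {..k}"
    by (rule heart_weights_leI) (rule orth_w[OF G(4) A_weight(2)])

  \<comment> \<open>\<open>E\<close> is cut at k + 1, which makes its subobject \<open>E1\<close>
    pure of weight k; \<open>G\<close> is cut at k, which makes its quotient \<open>G2\<close> pure
    of weight k.\<close>
  have s: "{k..} \<inter> {..<k + 1} = {k}" "{k..} \<inter> {k + 1..} = {k + 1..}" "{..k} \<inter> {..<k} = {..<k}" "{..k} \<inter> {k..} = {k}"
    by auto
  obtain E1 E2 where E12: "is_extension E1 E E2" "E1 \<in> heart_of {k}" "E2 \<in> heart_of {k + 1..}"
    using weight_filtration[OF E_geq, of "k + 1"] unfolding s by blast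
  obtain G1 G2 where G12: "is_extension G1 G G2" "G1 \<in> heart_of {..<k}" "G2 \<in> heart_of {k}"
    using weight_filtration[OF G_leq, of k] unfolding s by blast

  obtain p p1 p2 where tp: "dist_tri C P M R0 p p1 p2" using P(1) by (rule is_extensionE)
  obtain l e l2 where te: "dist_tri C L P E l e l2" using E(1) by (rule is_extensionE)
  obtain q0 q q2 where tq: "dist_tri C L0 N Q q0 q q2" using Q(1) by (rule is_extensionE)
  obtain g g1 g2 where tg: "dist_tri C G Q R g g1 g2" using G(1) by (rule is_extensionE)
  obtain x y x2 where tx: "dist_tri C E1 E E2 x y x2" using E12(1) by (rule is_extensionE)
  obtain z w z2 where tz: "dist_tri C G1 G G2 z w z2" using G12(1) by (rule is_extensionE)
  have mp: "p \<in> mor C P M" and mq: "q \<in> mor C N Q" using tri_mor[OF tp] tri_mor[OF tq] by auto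
  have me: "l \<in> mor C L P" "e \<in> mor C P E" using tri_mor[OF te] by auto
  have mg: "g \<in> mor C G Q" "g1 \<in> mor C Q R" using tri_mor[OF tg] by auto
  have mx: "x \<in> mor C E1 E" "y \<in> mor C E E2" using tri_mor[OF tx] by auto
  have mz: "z \<in> mor C G1 G" "w \<in> mor C G G2" using tri_mor[OF tz] by auto

  let ?c = "q \<bullet> (\<alpha> \<bullet> p)"
  have c: "?c \<in> mor C P Q" using cmp_mor[OF cmp_mor[OF mp a] mq] .
  \<comment> \<open>Nothing in degrees \<le> -1 maps to \<open>Q\<close>, and \<open>E\<close> has
    no maps to \<open>R\<close>, so the composite is induced by a map \<open>h\<close> of heart
    objects.\<close>
  have "orth L Q" by (rule orth_t[OF E(2) Q(3)]) simp
  then obtain c1 where c1: "c1 \<in> mor C E Q" "c1 \<bullet> e = ?c" using tri_extend_orth[OF te c] by blast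
  have "orth E R" by (rule orth_t[OF \<open>E \<in> t_le C Tle 0\<close> G(3)]) simp
  then obtain h where h: "h \<in> mor C E G" "g \<bullet> h = c1" using tri_lift_orth[OF tg c1(1)] by blast

  text \<open>The weight \<open>k\<close> part of \<open>E\<close> lifts to \<open>P\<close>, and that of \<open>G\<close> extends to \<open>Q\<close>, because the obstructions
    live in \<open>Hom(E1, L[1])\<close> and \<open>Hom(R[-1], G2)\<close>.\<close>
  have "orth E1 (shift C 1 L)"
    by (rule orth_w[of _ k _ "k + 1"]) (use heart_of_w_le[OF E12(2)] E(4) in \<open>simp_all add: shift_mem_w_ge\<close>)
  then obtain x' where x': "x' \<in> mor C E1 P" "e \<bullet> x' = x"
    using tri_lift_orth[OF tri_rotate_left[OF te] mx(1)] by blast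
  have "orth (shift C (- 1) R) G2"
    by (rule orth_w[of _ "k - 1" _ k]) (use heart_of_w_ge[OF G12(3)] G(5) in \<open>simp_all add: shift_mem_w_le\<close>)
  then obtain w' where w': "w' \<in> mor C Q G2" "w' \<bullet> g = w"
    using tri_extend_orth[OF tri_rotate_right[OF tg] mz(2)] by blast

  \<comment> \<open>The lifts connect the pure parts through M and N themselves, so that \<alpha> is
    a factor and radicality passes to the composite.\<close>
  have "(w' \<bullet> q) \<bullet> (\<alpha> \<bullet> (p \<bullet> x')) \<in> radical C E1 G2"
    by (rule radical_cmp[OF r cmp_mor[OF x'(1) mp] cmp_mor[OF mq w'(1)]])
  then have z0: "(w' \<bullet> q) \<bullet> (\<alpha> \<bullet> (p \<bullet> x')) = zero_mor C E1 G2"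
  proof (rule radical_extension_closure_eq_zero[where S = "A k", rotated -1])
    show "E1 \<in> extension_closure C (A k)" "G2 \<in> extension_closure C (A k)"
      using E12(2) G12(3) by (simp_all add: heart_of_def)
  qed (auto intro: orth_A_shift_1 semisimple_radical_eq_zero[OF A_abelian A_semisimple])
  have "(w' \<bullet> q) \<bullet> (\<alpha> \<bullet> (p \<bullet> x')) = w' \<bullet> (?c \<bullet> x')"
    using cmp_assoc[OF cmp_mor[OF cmp_mor[OF x'(1) mp] a] mq w'(1)] cmp_assoc[OF x'(1) mp a]
      cmp_assoc[OF x'(1) cmp_mor[OF mp a] mq] by simp
  also have "\<dots> = w' \<bullet> (g \<bullet> (h \<bullet> x))"
    using c1(2)[symmetric] h(2)[symmetric] x'(2)[symmetric] cmp_assoc[OF x'(1) me(2) c1(1)]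
      cmp_assoc[OF mx(1) h(1) mg(1)] by simp
  also have "\<dots> = w \<bullet> (h \<bullet> x)" using cmp_assoc[OF cmp_mor[OF mx(1) h(1)] mg(1) w'(1)] w'(2) by simp
  finally have "w \<bullet> (h \<bullet> x) = zero_mor C E1 G2" using z0 by simp
  \<comment> \<open>The vanishing of w h x puts h x into \<open>G1\<close>, of weights < k, so h x =
    0; then \<open>h\<close> factors through \<open>E2\<close>, whose weights exceed those of
    \<open>G\<close>.\<close>
  from tri_lift[OF tz cmp_mor[OF mx(1) h(1)] this]
  obtain u where u: "u \<in> mor C E1 G1" "z \<bullet> u = h \<bullet> x" by blast
  have "orth E1 G1" by (rule orth_heart_of[OF E12(2) G12(2)]) simp
  then have "h \<bullet> x = zero_mor C E1 G" using u orthD[OF _ u(1)] cmp_zero_right[OF mz(1)] by metis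
  from tri_extend[OF tx h(1) this] obtain v where v: "v \<in> mor C E2 G" "v \<bullet> y = h" by blast
  have "orth E2 G" by (rule orth_heart_of[OF E12(3) G_leq]) auto
  then have "h = zero_mor C E G" using v orthD[OF _ v(1)] cmp_zero_left[OF mx(2)] by metis
  then have c0: "?c = zero_mor C P Q"
    using c1(2)[symmetric] h(2)[symmetric] cmp_zero_right[OF mg(1)] cmp_zero_left[OF me(2)] by simp

  show ?thesis
    unfolding cohom_null_def
  proof (intro ballI)
    fix X Y u v
    assume X: "X \<in> t_le C Tle 0" and Y: "Y \<in> t_ge C Tge 0" and u: "u \<in> mor C X M" and v: "v \<in> mor C N Y"
    have "orth X R0" by (rule orth_t[OF X P(3)]) simp
    then obtain u' where u': "u' \<in> mor C X P" "p \<bullet> u' = u" using tri_lift_orth[OF tp u] by blast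
    have "orth L0 Y" by (rule orth_t[OF Q(2) Y]) simp
    then obtain v' where v': "v' \<in> mor C Q Y" "v' \<bullet> q = v" using tri_extend_orth[OF tq v] by blast
    have "v \<bullet> (\<alpha> \<bullet> u) = v' \<bullet> (?c \<bullet> u')"
      using u'(2)[symmetric] v'(2)[symmetric] cmp_assoc[OF cmp_mor[OF cmp_mor[OF u'(1) mp] a] mq v'(1)]
        cmp_assoc[OF u'(1) mp a] cmp_assoc[OF u'(1) cmp_mor[OF mp a] mq] by simp
    then show "v \<bullet> (\<alpha> \<bullet> u) = zero_mor C X Y"
      using c0 cmp_zero_left[OF u'(1)] cmp_zero_right[OF v'(1)] by simp
  qed
qed

theorem cohom_mor_zero_iff_radical:
  assumes M: "M \<in> w_ge C Wge n" and N: "N \<in> w_le C Wle n" and a: "\<alpha> \<in> mor C M N"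
  shows "(\<forall>m. cohom_mor C Tle Tge m M N \<alpha> = zero_mor C (cohom C Tle Tge m M) (cohom C Tle Tge m N))
    \<longleftrightarrow> \<alpha> \<in> radical C M N"
proof -
  have "cohom_null m M N \<alpha>" if r: "\<alpha> \<in> radical C M N" for m
  proof -
    \<comment> \<open>Both weight bounds move from n to n + m, so they still agree and degree 0
      covers every m.\<close>
    have "cohom_null 0 (shift C m M) (shift C m N) (shift_mor C m \<alpha>)"
      by (rule radical_imp_cohom_null_0[OF _ _ radical_shift[OF r], where k = "n + m"])
        (use M N in \<open>simp_all add: shift_mem_w_ge shift_mem_w_le\<close>)
    then show ?thesis using cohom_null_shift_iff[OF a, of 0 m] by simp
  qed
  then show ?thesis
    unfolding cohom_mor_eq_zero_iff[OF a] using cohom_null_imp_radical[OF a] by blast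
qed

end

theorem theorem1p9:
  fixes F :: "('f, 'r) ring_scheme" and Ks :: "'k ring list"
    and C :: "('f, 'o, 'm, 'z) tricat_scheme"
    and Wle Wge Tle Tge :: "'o set"
    and n :: int and M N :: 'o and \<alpha> :: 'm
  assumes "product_of_char_zero_fields F Ks"
    and "triangulated_category F C"
    and "bounded_weight_structure F C Wle Wge"
    and "bounded_t_structure F C Tle Tge"
    and "transversal C Wle Wge Tle Tge"
    and "M \<in> w_ge C Wge n" and "N \<in> w_le C Wle n"
    and "\<alpha> \<in> mor C M N"
  shows "(\<forall>m :: int. cohom_mor C Tle Tge m M N \<alpha> =
            zero_mor C (cohom C Tle Tge m M) (cohom C Tle Tge m N))
         \<longleftrightarrow> \<alpha> \<in> radical C M N"
proof -
  obtain A where A: "\<forall>i. abelian_subcategory C (A i) \<and> semisimple_subcategory C (A i)"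
    "\<forall>i j s. s < 0 \<or> s > i - j \<or> (s = 0 \<and> i \<noteq> j) \<longrightarrow>
        (\<forall>X \<in> A i. \<forall>Y \<in> A j. mor C X (shift C s Y) = {zero_mor C X (shift C s Y)})"
    "heart Tle Tge = extension_closure C (\<Union>i. A i)"
    "w_le C Wle 0 \<inter> w_ge C Wge 0 = finite_sums C (\<Union>i :: int. shift C (- i) ` A i)"
    using assms(5) unfolding transversal_def by blast
  interpret w: bounded_weight_structure F C Wle Wge by fact
  interpret t: bounded_t_structure F C Tle Tge by fact
  interpret transversal_structures F C Wle Wge Tle Tge A
  proof
    show "abelian_subcategory C (A i)" "semisimple_subcategory C (A i)" for i using A(1) by auto
    show "mor C X (shift C s Y) = {zero_mor C X (shift C s Y)}"
      if "s < 0 \<or> s > i - j \<or> (s = 0 \<and> i \<noteq> j)" "X \<in> A i" "Y \<in> A j" for s i j X Y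
      using A(2) that by blast
  qed fact+
  show ?thesis by (rule cohom_mor_zero_iff_radical) fact+
qed

end
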